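(* Suppose (A.1) and (A.2) hold, and let $(k_n)$ be integers with $1\le k_n<n$ and $(T_n)$ positive numbers such that $k_n\to\infty$, $k_n/n\to0$, $T_n\log(n/k_n)\to1$ and $k_n^{1/2}b(\log(n/k_n))\to\lambda\in\mathbb{R}$. Then $$k_n^{1/2}\big(\hat\theta_n-\theta-b(\log(n/k_n))-\theta a_n\big)\xrightarrow{d}\mathcal N(0,\theta^2).$$
   Context: Let $X_1,\dots,X_n$ be i.i.d. random variables with cumulative distribution function $F$, and $X_{1,n}\le\dots\le X_{n,n}$ their order statistics. Assumption (A.1): there is $\theta>0$ such that $1-F(x)=\exp(-H(x))$ for $x\ge x_0\ge 0$, and the generalized inverse $H^{\leftarrow}(t)=\inf\{x: H(x)\ge t\}$ satisfies $H^{\leftarrow}(t)=t^\theta\ell(t)$ with $\ell$ slowly varying at infinity. Assumption (A.2): there exist $\rho\le 0$ and a function $b$ with $b(x)\to0$ as $x\to\infty$ such that, uniformly locally on $\lambda\ge1$, $\log(\ell(\lambda x)/\ell(x))\sim b(x)K_\rho(\lambda)$ as $x\to\infty$, where $K_\rho(\lambda)=\int_1^\lambda u^{\rho-1}du$. Estimator: $\hat\theta_n=\frac{1}{T_n}\frac{1}{k_n}\sum_{i=1}^{k_n}(\log X_{n-i+1,n}-\log X_{n-k_n+1,n})$. For $t>0$: $\mu_0(t)=\int_0^\infty \log(1+x/t)e^{-x}dx$, and $a_n=\mu_0(\log(n/k_n))/T_n-1$. *)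

theory Defs
  imports "HOL-Probability.Probability"
begin

definition order_stat :: "(nat \<Rightarrow> 'a \<Rightarrow> real) \<Rightarrow> nat \<Rightarrow> nat \<Rightarrow> 'a \<Rightarrow> real" where
  "order_stat X n i \<omega> = sort (map (\<lambda>j. X j \<omega>) [1..<n+1]) ! (i - 1)"

text \<open>Generalized inverse of H (H being given on [x0, infinity)).\<close>
definition gen_inv :: "(real \<Rightarrow> real) \<Rightarrow> real \<Rightarrow> real \<Rightarrow> real" where
  "gen_inv H x0 t = Inf {x. x \<ge> x0 \<and> H x \<ge> t}"

definition slowly_varying :: "(real \<Rightarrow> real) \<Rightarrow> bool" where
  "slowly_varying l \<longleftrightarrow> (\<forall>\<^sub>F x in at_top. l x > 0) \<and>
     (\<forall>c>0. ((\<lambda>x. l (c * x) / l x) \<longlongrightarrow> 1) at_top)"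

definition K_rho :: "real \<Rightarrow> real \<Rightarrow> real" where
  "K_rho \<rho> lam = (LBINT u=1..lam. u powr (\<rho> - 1))"

definition mu0 :: "real \<Rightarrow> real" where
  "mu0 t = (LBINT x:{0..}. ln (1 + x / t) * exp (- x))"

definition theta_hat :: "(nat \<Rightarrow> 'a \<Rightarrow> real) \<Rightarrow> (nat \<Rightarrow> nat) \<Rightarrow> (nat \<Rightarrow> real) \<Rightarrow> nat \<Rightarrow> 'a \<Rightarrow> real" where
  "theta_hat X k T n \<omega> = 1 / T n * (1 / real (k n)) *
     (\<Sum>i=1..k n. ln (order_stat X n (n - i + 1) \<omega>) - ln (order_stat X n (n - k n + 1) \<omega>))"

end

(* Write X_i = q(E_i) with E_i standard exponential and q the quantile function in exponential
   scale, so that q agrees with the generalized inverse of H far out. Splitting according to which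
   variable is the k-th largest and which ones lie above it, memorylessness shows that, given
   E_{n-k+1,n} = y, the Hill sum is a sum of k-1 independent copies of ln q(y+Z) - ln q(y) with Z
   exponential. Hence its characteristic function is a mixture over y of explicit powers. The mixing
   law concentrates on |y - ln(n/k)| = O(k^(-1/2)), and (A.2), extended to a second-order Potter bound
   valid for all factors >= 1, yields the mean and variance of ln q(y+Z) - ln q(y) precisely enough
   for a triangular-array central limit theorem along every such sequence y_n. *)
theory Submission
  imports Defs
begin

section \<open>Order statistics of independent variables\<close>

text \<open>The threshold is random, yet its fluctuation does not enlarge the limit variance
  theta^2. The reason is scale: the mean of ln q(y+Z) - ln q(y) is close to theta *
  \<open>mu0 y\<close>, and \<open>mu0\<close> moves by at most |y - t| / (y t). With t = ln(n/k),
  |y - t| = O(k^(-1/2)) and T_n ~ 1/t, the normalised mean shifts by O(k^(-1/2) / t) only. The bias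
  is b with coefficient 1 whatever rho is, because the factors 1 + Z/y tend to 1 and every
  \<open>K_rho\<close> has slope 1 there.

  Two obstacles shape the proof. F may have atoms below x0 or jumps of H, so the X_i can tie; ranks
  are therefore taken among the E_i, which are almost surely distinct, and weak monotonicity of q
  carries them over. And b is known at t while the argument needs it at y; the required regular
  variation of b is not assumed but extracted from (A.2) by expanding one log-ratio of the slowly
  varying function in two ways.

  Since theta + theta a_n = theta * \<open>mu0 t\<close> / T_n, the centring in the theorem is theta
  * \<open>mu0 t\<close> / T_n + b(t). Only k-1 summands are nonzero although the estimator divides
  by k; the missing one costs a vanishing shift.\<close>

lemma sorted_nth_le_iff:
  fixes xs :: "'a::linorder list"
  assumes "sorted xs" "m < length xs"
  shows "xs ! m \<le> c \<longleftrightarrow> m < length (filter (\<lambda>x. x \<le> c) xs)"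
  using assms
proof (induction xs arbitrary: m)
  case Nil then show ?case by simp
next
  case (Cons a xs)
  show ?case
  proof (cases m)
    case 0
    have "\<not> a \<le> c \<Longrightarrow> filter (\<lambda>x. x \<le> c) xs = []"
      using Cons.prems by (auto simp: filter_empty_conv)
    then show ?thesis using 0 by auto
  next
    case (Suc m')
    have "xs ! m' \<in> set xs" using Cons.prems Suc by auto
    then have "a \<le> xs ! m'" using Cons.prems by auto
    moreover have "\<not> a \<le> c \<Longrightarrow> filter (\<lambda>x. x \<le> c) xs = []"
      using Cons.prems by (auto simp: filter_empty_conv)
    ultimately show ?thesis using Cons Suc by auto
  qed
qed

text \<open>Past the end, \<open>!\<close> recurses down to the empty list, so the unspecified value
  cannot depend on the entries. This makes \<open>order_stat\<close> a constant function of the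
  sample point when the rank is too large, hence measurable there too.\<close>

lemma nth_overflow_eq: "length xs \<le> m \<Longrightarrow> xs ! m = [] ! (m - length xs)"
proof (induction xs arbitrary: m)
  case (Cons a xs) then show ?case by (cases m) auto
qed simp

lemma order_stat_measurable [measurable]:
  assumes [measurable]: "\<And>j. j \<in> {1..n} \<Longrightarrow> X j \<in> borel_measurable M"
  shows "order_stat X n i \<in> borel_measurable M"
proof (cases "i - 1 < n")
  case True
  show ?thesis
  proof (rule borel_measurableI_le)
    fix c :: real
    \<comment> \<open>Rank events become counting events: a sum of indicators, whose measurability
      is automatic.\<close>
    have "order_stat X n i \<omega> \<le> c \<longleftrightarrow> real (i - 1) < (\<Sum>j\<in>{1..n}. if X j \<omega> \<le> c then 1 else 0)" for \<omega>
    proof -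
      let ?xs = "map (\<lambda>j. X j \<omega>) [1..<n+1]"
      have "order_stat X n i \<omega> \<le> c \<longleftrightarrow> i - 1 < length (filter (\<lambda>x. x \<le> c) (sort ?xs))"
        unfolding order_stat_def using True by (intro sorted_nth_le_iff) auto
      also have "length (filter (\<lambda>x. x \<le> c) (sort ?xs)) = length (filter (\<lambda>x. x \<le> c) ?xs)"
        by (metis filter_sort length_sort)
      also have "\<dots> = length (filter (\<lambda>j. X j \<omega> \<le> c) [1..<n+1])"
        by (simp add: filter_map o_def)
      also have "\<dots> = card {j\<in>{1..n}. X j \<omega> \<le> c}"
        by (subst distinct_card[symmetric]) (auto intro!: arg_cong[where f=card])
      finally show ?thesis
        by (simp add: sum.If_cases Int_def)
    qed
    then show "{\<omega> \<in> space M. order_stat X n i \<omega> \<le> c} \<in> sets M" by simp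
  qed
next
  case False
  then have "order_stat X n i = (\<lambda>\<omega>. [] ! (i - 1 - n))"
    unfolding order_stat_def fun_eq_iff by (subst nth_overflow_eq) (auto simp del: upt_Suc)
  then show ?thesis by simp
qed

text \<open>The inequalities are weak because the quantile function can create ties. Among tied
  values any admissible choice of \<open>j\<close> and \<open>S\<close> describes the same sorted
  list, so the sum does not depend on the choice.\<close>

lemma sum_order_stat_above:
  fixes g :: "real \<Rightarrow> real"
  assumes j: "j \<in> {1..n}" and S: "S \<subseteq> {1..n} - {j}" and card: "card S = k - 1" and k: "1 \<le> k" "k \<le> n"
    and above: "\<And>i. i \<in> S \<Longrightarrow> X j \<omega> \<le> X i \<omega>"
    and below: "\<And>i. i \<in> {1..n} - {j} - S \<Longrightarrow> X i \<omega> \<le> X j \<omega>"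
  shows "(\<Sum>i=1..k. g (order_stat X n (n - i + 1) \<omega>) - g (order_stat X n (n - k + 1) \<omega>))
    = (\<Sum>i\<in>S. g (X i \<omega>) - g (X j \<omega>))"
proof -
  define R where "R = {1..n} - {j} - S"
  define f where "f = (\<lambda>i. X i \<omega>)"
  have fS: "finite S" using S finite_subset by blast
  define us where "us = sort (map f (sorted_list_of_set R))"
  define vs where "vs = sort (map f (sorted_list_of_set S))"
  have un: "{1..n} = R \<union> ({j} \<union> S)" "R \<inter> ({j} \<union> S) = {}" "{j} \<inter> S = {}"
    using j S by (auto simp: R_def)
  have fR: "finite R" by (simp add: R_def)
  have "card {1..n} = card R + (1 + card S)"
    unfolding un(1) using un fS fR by (subst card_Un_disjoint) (auto simp: card_Un_disjoint)
  then have len: "length us = n - k" "length vs = k - 1"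
    using card k by (auto simp: us_def vs_def)
  have mset_upt': "mset [1..<n+1] = mset_set R + ({#j#} + mset_set S)"
  proof -
    have "mset [1..<n+1] = mset_set {1..n}" by (simp add: atLeastLessThanSuc_atLeastAtMost del: upt_Suc)
    also have "\<dots> = mset_set R + (mset_set {j} + mset_set S)"
      unfolding un(1) using un fS fR by (subst mset_set_Union) (auto simp: mset_set_Union)
    finally show ?thesis by simp
  qed
  have msR: "mset (sorted_list_of_set R) = mset_set R" and msS: "mset (sorted_list_of_set S) = mset_set S"
    using fR fS by (simp_all flip: mset_set_set)
  \<comment> \<open>The sorted sample is the block below the threshold, the threshold, and the block
    above it; the first block has length \<open>n - k\<close>.\<close>
  have srt: "sort (map f [1..<n+1]) = us @ f j # vs"
  proof (rule properties_for_sort)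
    show "mset (us @ f j # vs) = mset (map f [1..<n + 1])"
      unfolding mset_map mset_upt' using msR msS by (simp add: us_def vs_def)
    have 1: "\<forall>x\<in>set us. x \<le> f j" and 2: "\<forall>x\<in>set vs. f j \<le> x"
      using fS fR above below by (auto simp: us_def vs_def f_def R_def)
    have "sorted us" "sorted vs" by (auto simp: us_def vs_def)
    then show "sorted (us @ f j # vs)" using 1 2 by (auto simp: sorted_append intro: order_trans)
  qed
  have os: "order_stat X n (n - i + 1) \<omega> = (f j # vs) ! (k - i)" if "i \<in> {1..k}" for i
  proof -
    have "order_stat X n (n - i + 1) \<omega> = (us @ f j # vs) ! (n - i)"
      using srt by (simp add: order_stat_def f_def del: upt_Suc)
    also have "\<dots> = (f j # vs) ! (k - i)"
    proof -
      have "\<not> n - i < length us" "n - i - length us = k - i" using that k len by auto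
      then show ?thesis by (simp only: nth_append if_False)
    qed
    finally show ?thesis .
  qed
  have osk: "order_stat X n (n - k + 1) \<omega> = f j" using os[of k] k by simp
  have "(\<Sum>i=1..k. g (order_stat X n (n - i + 1) \<omega>) - g (order_stat X n (n - k + 1) \<omega>))
      = (\<Sum>i=1..k. g ((f j # vs) ! (k - i)) - g (f j))"
    unfolding osk using os by (intro sum.cong) auto
  also have "\<dots> = (\<Sum>m<k. g ((f j # vs) ! m) - g (f j))"
    by (rule sum.reindex_bij_witness[of _ "\<lambda>m. k - m" "\<lambda>i. k - i"]) auto
  also have "\<dots> = (\<Sum>x\<leftarrow>f j # vs. g x - g (f j))"
  proof -
    have "length (f j # vs) = k" using len k by simp
    then show ?thesis
      by (subst sum_list_sum_nth) (auto simp: atLeast0LessThan simp del: list.map intro!: sum.cong)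
  qed
  \<comment> \<open>The head of the list is the threshold itself and contributes 0, which is why
    \<open>k - 1\<close> summands remain.\<close>
  also have "\<dots> = sum_list (map (\<lambda>x. g x - g (f j)) vs)" by simp
  also have "\<dots> = sum_mset (image_mset (\<lambda>x. g x - g (f j)) (mset vs))"
    by (subst sum_mset_sum_list[symmetric]) (simp only: mset_map)
  also have "\<dots> = (\<Sum>i\<in>S. g (f i) - g (f j))"
    using msS by (simp add: vs_def multiset.map_comp o_def sum_unfold_sum_mset)
  finally show ?thesis by (simp add: f_def)
qed

text \<open>Fubini in coordinate \<open>i\<close>: with the others fixed, the diagonal is a single
  point, and \<open>N\<close> has no atoms.\<close>

lemma AE_PiM_neq:
  fixes N :: "real measure"
  assumes "prob_space N" and [measurable_cong]: "sets N = sets borel" and atomless: "\<And>x. emeasure N {x} = 0"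
    and I: "finite I" "i \<in> I" "j \<in> I" "i \<noteq> j"
  shows "AE x in PiM I (\<lambda>_. N). x i \<noteq> x j"
proof -
  interpret N: prob_space N by fact
  interpret product_sigma_finite "\<lambda>_. N" by standard
  define J where "J = I - {i}"
  have J: "finite J" "i \<notin> J" "j \<in> J" "insert i J = I" using I by (auto simp: J_def)
  have "(\<lambda>x. x i) \<in> PiM I (\<lambda>_. N) \<rightarrow>\<^sub>M N" "(\<lambda>x. x j) \<in> PiM I (\<lambda>_. N) \<rightarrow>\<^sub>M N"
    using I by (auto intro!: measurable_component_singleton)
  then have [measurable]: "(\<lambda>x. x i) \<in> borel_measurable (PiM I (\<lambda>_. N))" "(\<lambda>x. x j) \<in> borel_measurable (PiM I (\<lambda>_. N))"
    by (simp_all add: measurable_cong_sets[OF refl assms(2)])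
  define f where "f x = (if x i = x j then 1 else 0 :: ennreal)" for x :: "'a \<Rightarrow> real"
  have [measurable]: "f \<in> borel_measurable (PiM I (\<lambda>_. N))" unfolding f_def by measurable
  have "(\<integral>\<^sup>+x. f x \<partial>PiM I (\<lambda>_. N)) = (\<integral>\<^sup>+x. (\<integral>\<^sup>+y. f (x(i := y)) \<partial>N) \<partial>PiM J (\<lambda>_. N))"
    using product_nn_integral_insert[of J i f] J by simp
  also have "(\<lambda>x. \<integral>\<^sup>+y. f (x(i := y)) \<partial>N) = (\<lambda>x. \<integral>\<^sup>+y. indicator {x j} y \<partial>N)"
    using I by (intro ext nn_integral_cong) (auto simp: f_def split: split_indicator)
  also have "\<dots> = (\<lambda>x. 0)" using atomless by (simp add: assms(2))
  finally have "AE x in PiM I (\<lambda>_. N). f x = 0"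
    by (subst nn_integral_0_iff_AE[symmetric]) simp_all
  then show ?thesis by eventually_elim (auto simp: f_def split: if_splits)
qed

text \<open>Existence and uniqueness together say that the indicators of the possible order patterns
  sum to exactly 1 at an injective point, so that an integral splits into one term per
  pattern.\<close>

lemma ex1_order_partition:
  fixes x :: "'i \<Rightarrow> real"
  assumes I: "finite I" and inj: "inj_on x I" and k: "1 \<le> k" "k \<le> card I"
  shows "\<exists>!p. p \<in> (SIGMA j:I. {S. S \<subseteq> I - {j} \<and> card S = k - 1}) \<and>
      (\<forall>i\<in>snd p. x (fst p) < x i) \<and> (\<forall>i\<in>I - {fst p} - snd p. x i < x (fst p))"
proof -
  \<comment> \<open>A set of the \<open>m\<close> largest entries is extended by the maximum of the
    rest.\<close>
  have upper: "\<exists>A\<subseteq>I. card A = m \<and> (\<forall>a\<in>A. \<forall>c\<in>I-A. x c < x a)" if "m \<le> card I" for m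
    using that
  proof (induction m)
    case 0 then show ?case by (intro exI[of _ "{}"]) auto
  next
    case (Suc m)
    then obtain A where A: "A \<subseteq> I" "card A = m" "\<forall>a\<in>A. \<forall>c\<in>I-A. x c < x a" by auto
    have fA: "finite A" using A I finite_subset by blast
    have "I - A \<noteq> {}" using A Suc.prems I by (metis Diff_eq_empty_iff card_mono fA not_less_eq_eq)
    then have "Max (x ` (I - A)) \<in> x ` (I - A)" using I by (intro Max_in) auto
    then obtain j where j: "j \<in> I - A" "x j = Max (x ` (I - A))" by auto
    have "x c < x j" if "c \<in> I - insert j A" for c
    proof -
      have "x c \<le> x j" unfolding j(2) using that I by (intro Max_ge) auto
      moreover have "x c \<noteq> x j" using inj_onD[OF inj, of c j] that j by auto
      ultimately show ?thesis by simp
    qed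
    then show ?case using A j fA by (intro exI[of _ "insert j A"]) auto
  qed
  obtain A where A: "A \<subseteq> I" "card A = k" "\<forall>a\<in>A. \<forall>c\<in>I-A. x c < x a" using upper k by metis
  have fA: "finite A" using A I finite_subset by blast
  have "A \<noteq> {}" using A k by auto
  then have "Min (x ` A) \<in> x ` A" using fA by (intro Min_in) auto
  then obtain j where j: "j \<in> A" "x j = Min (x ` A)" by auto
  have jm: "x j < x i" if "i \<in> A - {j}" for i
  proof -
    have "x j \<le> x i" unfolding j(2) using that fA by (intro Min_le) auto
    moreover have "x i \<noteq> x j" using inj_onD[OF inj, of i j] that j A by auto
    ultimately show ?thesis by simp
  qed
  \<comment> \<open>Two different top sets of equal size each contain an element that the other
    lacks, and each of these two would have to exceed the other.\<close>
  have unique: "A' = B'" if "A' \<subseteq> I" "card A' = k" "\<forall>a\<in>A'. \<forall>c\<in>I-A'. x c < x a"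
      "B' \<subseteq> I" "card B' = k" "\<forall>a\<in>B'. \<forall>c\<in>I-B'. x c < x a" for A' B'
  proof (rule ccontr)
    assume ne: "A' \<noteq> B'"
    have f: "finite A'" "finite B'" using that I finite_subset by blast+
    have "\<not> A' \<subseteq> B'" "\<not> B' \<subseteq> A'" using ne f that(2,5) card_subset_eq by metis+
    then obtain a c where "a \<in> A' - B'" "c \<in> B' - A'" by auto
    then have "x c < x a" "x a < x c" using that by auto
    then show False by simp
  qed
  show ?thesis
  proof (rule ex1I[of _ "(j, A - {j})"])
    show "(j, A - {j}) \<in> (SIGMA j:I. {S. S \<subseteq> I - {j} \<and> card S = k - 1}) \<and>
      (\<forall>i\<in>snd (j, A - {j}). x (fst (j, A - {j})) < x i) \<and>
      (\<forall>i\<in>I - {fst (j, A - {j})} - snd (j, A - {j}). x i < x (fst (j, A - {j})))"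
      using A j jm fA by (auto simp flip: j(2))
  next
    fix p assume p: "p \<in> (SIGMA j:I. {S. S \<subseteq> I - {j} \<and> card S = k - 1}) \<and>
      (\<forall>i\<in>snd p. x (fst p) < x i) \<and> (\<forall>i\<in>I - {fst p} - snd p. x i < x (fst p))"
    obtain l S where pS: "p = (l, S)" by (cases p)
    have S: "l \<in> I" "S \<subseteq> I - {l}" "card S = k - 1" "\<forall>i\<in>S. x l < x i" "\<forall>i\<in>I - {l} - S. x i < x l"
      using p pS by auto
    have fS: "finite S" using S I finite_subset by blast
    have "insert l S = A"
    proof (rule unique)
      show "card (insert l S) = k" using S fS k by (subst card_insert_disjoint) auto
      show "\<forall>a\<in>insert l S. \<forall>c\<in>I - insert l S. x c < x a" using S by (auto intro: less_trans)
    qed (use A S in auto)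
    moreover have "l = j"
    proof (rule ccontr)
      assume "l \<noteq> j"
      then have "j \<in> S" "l \<in> A - {j}" using \<open>insert l S = A\<close> j by auto
      then show False using jm[of l] S(4) by fastforce
    qed
    ultimately show "p = (j, A - {j})" using pS S by auto
  qed
qed

text \<open>On each order pattern \<open>G\<close> factors into terms that involve the pivot
  \<open>x j\<close> and one further coordinate. For a fixed pivot Fubini therefore integrates
  factor by factor: \<open>k - 1\<close> factors above it and \<open>card I - k\<close> below.
  \<open>V\<close> is a set of full measure on which this factorisation may rely.\<close>

lemma integral_order_partition:
  fixes N :: "real measure" and h :: "real \<Rightarrow> real \<Rightarrow> complex" and G :: "('i \<Rightarrow> real) \<Rightarrow> complex"
  assumes "prob_space N" and N: "sets N = sets borel" and atomless: "\<And>x. emeasure N {x} = 0"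
    and I: "finite I" and k: "1 \<le> k" "k \<le> card I"
    and G [measurable]: "G \<in> borel_measurable (PiM I (\<lambda>_. N))"
    and h: "case_prod h \<in> borel_measurable (borel \<Otimes>\<^sub>M borel)" and h1: "\<And>y x. norm (h y x) \<le> 1"
    and V: "AE y in N. y \<in> V"
    and eq: "\<And>x j S. (\<And>i. i \<in> I \<Longrightarrow> x i \<in> V) \<Longrightarrow> j \<in> I \<Longrightarrow> S \<subseteq> I - {j} \<Longrightarrow> card S = k - 1 \<Longrightarrow>
      (\<And>i. i \<in> S \<Longrightarrow> x j < x i) \<Longrightarrow> (\<And>i. i \<in> I - {j} - S \<Longrightarrow> x i < x j) \<Longrightarrow> G x = (\<Prod>i\<in>S. h (x j) (x i))"
  shows "(LINT x|PiM I (\<lambda>_. N). G x) = of_nat (card I * ((card I - 1) choose (k - 1))) *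
    (LINT y|N. (LINT x|N. (if y < x then h y x else 0)) ^ (k - 1) * of_real (measure N {..<y}) ^ (card I - k))"
proof -
  interpret N: prob_space N by fact
  interpret product_sigma_finite "\<lambda>_. N" by standard
  interpret PI: prob_space "PiM I (\<lambda>_. N)" by (intro prob_space_PiM) (rule \<open>prob_space N\<close>)
  note [measurable_cong] = N
  have Nborel: "borel_measurable N = borel_measurable borel" by (rule measurable_cong_sets) (simp_all add: N)
  have [measurable]: "(\<lambda>x. h (f x) (g x)) \<in> borel_measurable K"
    if "f \<in> borel_measurable K" "g \<in> borel_measurable K" for f g and K :: "'k measure"
    using measurable_compose[OF measurable_Pair[OF that] h] by simp
  define P where "P = (SIGMA j:I. {S. S \<subseteq> I - {j} \<and> card S = k - 1})"
  \<comment> \<open>One factor per index other than the pivot: members of \<open>S\<close> must lie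
    above and carry the weight \<open>h\<close>, all others must lie below. The order constraint is
    thus itself a product.\<close>
  define w where "w S i y x = (if i \<in> S then (if y < x then h y x else 0) else (if x < y then 1 else 0))"
    for S :: "'i set" and i y x
  define F where "F p x = (\<Prod>i\<in>I - {fst p}. w (snd p) i (x (fst p)) (x i))" for p and x :: "'i \<Rightarrow> real"
  define c where "c y = (LINT x|N. (if y < x then h y x else 0)) ^ (k - 1) * of_real (measure N {..<y}) ^ (card I - k)" for y
  have finP: "finite P" using I by (auto simp: P_def intro!: finite_SigmaI)
  have w1: "norm (w S i y x) \<le> 1" for S i y x using h1 by (auto simp: w_def)
  have [measurable]: "(\<lambda>x. w S i (f x) (g x)) \<in> borel_measurable K"
    if [measurable]: "f \<in> borel_measurable K" "g \<in> borel_measurable K" for S i f g and K :: "'k measure"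
    unfolding w_def by measurable
  have comp: "(\<lambda>x. x i) \<in> borel_measurable (PiM I (\<lambda>_. N))" if "i \<in> I" for i
    using measurable_component_singleton[OF that, of "\<lambda>_. N"] by (simp add: measurable_cong_sets[OF refl N])
  have F_meas: "F p \<in> borel_measurable (PiM I (\<lambda>_. N))" if "p \<in> P" for p
  proof -
    have "fst p \<in> I" using that by (auto simp: P_def)
    then have [measurable]: "(\<lambda>x. x (fst p)) \<in> borel_measurable (PiM I (\<lambda>_. N))" by (rule comp)
    show ?thesis unfolding F_def using comp by (intro borel_measurable_prod) auto
  qed
  have F_int: "integrable (PiM I (\<lambda>_. N)) (F p)" if "p \<in> P" for p
  proof (rule PI.integrable_const_bound[where B=1])
    have "norm (F p x) \<le> 1" for x
      unfolding F_def using w1 by (intro norm_prod_le[THEN order_trans] prod_le_1) auto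
    then show "AE x in PiM I (\<lambda>_. N). norm (F p x) \<le> 1" by simp
  qed (rule F_meas[OF that])
  have "AE x in PiM I (\<lambda>_. N). inj_on x I"
  proof -
    have "AE x in PiM I (\<lambda>_. N). \<forall>i\<in>I. \<forall>j\<in>I. i \<noteq> j \<longrightarrow> x i \<noteq> x j"
      using AE_PiM_neq[OF \<open>prob_space N\<close> N atomless I] I
      by (intro AE_finite_allI) (auto intro!: AE_I2 simp del: AE_I2)
    then show ?thesis by eventually_elim (auto simp: inj_on_def)
  qed
  moreover have "AE x in PiM I (\<lambda>_. N). \<forall>i\<in>I. x i \<in> V"
    using I V \<open>prob_space N\<close> by (intro AE_finite_allI AE_PiM_component) auto
  ultimately have "AE x in PiM I (\<lambda>_. N). G x = (\<Sum>p\<in>P. F p x)"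
  proof eventually_elim
    case (elim x)
    let ?C = "\<lambda>p. (\<forall>i\<in>snd p. x (fst p) < x i) \<and> (\<forall>i\<in>I - {fst p} - snd p. x i < x (fst p))"
    obtain p where p: "p \<in> P" "?C p" and uniq: "\<And>q. q \<in> P \<Longrightarrow> ?C q \<Longrightarrow> q = p"
      using ex1_order_partition[OF I elim(1) k, folded P_def] by metis
    \<comment> \<open>Any pattern other than the true one violates a constraint at some index, and
      one vanishing factor kills the product.\<close>
    have zero: "F q x = 0" if "q \<in> P" "q \<noteq> p" for q
    proof -
      have "\<not> ?C q" using uniq[of q] that by argo
      moreover have "snd q \<subseteq> I - {fst q}" using that by (auto simp: P_def)
      ultimately have "\<exists>i\<in>I - {fst q}. w (snd q) i (x (fst q)) (x i) = 0"
        by (smt (verit) DiffE DiffI subsetD w_def)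
      then obtain i where "i \<in> I - {fst q}" "w (snd q) i (x (fst q)) (x i) = 0" by blast
      then show ?thesis unfolding F_def using I by (intro prod_zero) auto
    qed
    have "(\<Sum>q\<in>P. F q x) = F p x"
      using finP p zero by (subst sum.remove[of _ p]) auto
    also have "\<dots> = (\<Prod>i\<in>I - {fst p}. if i \<in> snd p then h (x (fst p)) (x i) else 1)"
      unfolding F_def w_def using p by (intro prod.cong) auto
    also have "\<dots> = (\<Prod>i\<in>snd p. h (x (fst p)) (x i))"
    proof -
      have "(I - {fst p}) \<inter> snd p = snd p" using p by (auto simp: P_def)
      then show ?thesis using I by (subst prod.If_cases) (auto simp: Int_def)
    qed
    also have "\<dots> = G x" using p elim(2) by (intro eq[symmetric]) (auto simp: P_def)
    finally show ?case by simp
  qed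
  then have "(LINT x|PiM I (\<lambda>_. N). G x) = (LINT x|PiM I (\<lambda>_. N). (\<Sum>p\<in>P. F p x))"
    using F_meas by (intro integral_cong_AE borel_measurable_sum) auto
  also have "\<dots> = (\<Sum>p\<in>P. LINT x|PiM I (\<lambda>_. N). F p x)"
    using F_int by (rule Bochner_Integration.integral_sum)
  \<comment> \<open>Exchangeability: only the sizes of the two groups enter, so every pattern
    contributes the same integral.\<close>
  also have "\<dots> = (\<Sum>p\<in>P. LINT y|N. c y)"
  proof (rule sum.cong)
    fix p assume pP: "p \<in> P"
    obtain j S where pS: "p = (j, S)" by (cases p)
    have S: "j \<in> I" "S \<subseteq> I - {j}" "card S = k - 1" using pP by (auto simp: P_def pS)
    define J where "J = I - {j}"
    have J: "finite J" "j \<notin> J" "{j} \<union> J = I" "{j} \<inter> J = {}" using I S by (auto simp: J_def)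
    have wint: "integrable N (\<lambda>x. w S i y x)" for i y
      by (rule N.integrable_const_bound[where B=1]) (auto intro: w1)
    have fS: "finite S" using S I finite_subset by blast
    have cJ: "card (J - S) = card I - k"
      using S I fS k by (simp add: J_def card_Diff_subset)
    have inner: "(LINT z|PiM J (\<lambda>_. N). F p (merge {j} J (x, z))) = c (x j)" for x
    proof -
      have "(LINT z|PiM J (\<lambda>_. N). F p (merge {j} J (x, z))) = (LINT z|PiM J (\<lambda>_. N). (\<Prod>i\<in>J. w S i (x j) (z i)))"
        unfolding F_def pS using J
        by (intro Bochner_Integration.integral_cong refl) (auto simp: J_def[symmetric] merge_def intro!: prod.cong)
      also have "\<dots> = (\<Prod>i\<in>J. LINT z|N. w S i (x j) z)"
        by (rule product_integral_prod) (use J wint in auto)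
      also have "\<dots> = (\<Prod>i\<in>J. if i \<in> S then LINT z|N. (if x j < z then h (x j) z else 0) else of_real (measure N {..<x j}))"
      proof (rule prod.cong)
        have "(LINT z|N. (if z < x j then 1 else 0 :: complex)) = (LINT z|N. of_real (indicator {..<x j} z))"
          by (intro Bochner_Integration.integral_cong) auto
        also have "\<dots> = of_real (measure N {..<x j})"
          by (subst integral_complex_of_real) (simp add: N)
        finally show "(LINT z|N. w S i (x j) z) = (if i \<in> S then LINT z|N. (if x j < z then h (x j) z else 0) else of_real (measure N {..<x j}))" for i
          by (simp add: w_def)
      qed simp
      also have "\<dots> = c (x j)"
      proof -
        have "J \<inter> {i. i \<in> S} = S" "J \<inter> - {i. i \<in> S} = J - S" using S by (auto simp: J_def)
        then show ?thesis using J S cJ by (subst prod.If_cases) (auto simp: c_def)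
      qed
      finally show ?thesis .
    qed
    have "(LINT x|PiM I (\<lambda>_. N). F p x) = (LINT x|PiM {j} (\<lambda>_. N). LINT z|PiM J (\<lambda>_. N). F p (merge {j} J (x, z)))"
      using product_integral_fold[of "{j}" J "F p"] J F_int[OF pP] by simp
    also have "\<dots> = (LINT x|PiM {j} (\<lambda>_. N). c (x j))" by (simp add: inner)
    also have "\<dots> = (LINT y|N. c y)"
    proof (rule product_integral_singleton)
      have "(\<lambda>y. LINT x|N. (if y < x then h y x else 0)) \<in> borel_measurable N" by measurable
      moreover have "(\<lambda>y. measure N {..<y}) \<in> borel_measurable N"
      proof -
        have "mono (\<lambda>y. measure N {..<y})"
          by (intro monoI N.finite_measure_mono) (auto simp: N)
        then show ?thesis unfolding Nborel by (rule borel_measurable_mono)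
      qed
      ultimately show "c \<in> borel_measurable N" unfolding c_def by measurable
    qed
    finally show "(LINT x|PiM I (\<lambda>_. N). F p x) = (LINT y|N. c y)" .
  qed simp
  also have "\<dots> = of_nat (card P) * (LINT y|N. c y)" by simp
  also have "card P = card I * ((card I - 1) choose (k - 1))"
    unfolding P_def using I by (subst card_SigmaI) (auto simp: n_subsets card_Diff_singleton)
  finally show ?thesis unfolding c_def .
qed

section \<open>The standard exponential law and its order statistics\<close>

definition exp_law :: "real measure" where
  "exp_law = density lborel (exponential_density 1)"

lemma sets_exp_law [simp, measurable_cong]: "sets exp_law = sets borel"
  and space_exp_law [simp]: "space exp_law = UNIV"
  by (simp_all add: exp_law_def)

lemma prob_space_exp_law: "prob_space exp_law"
  unfolding exp_law_def by (rule prob_space_exponential_density) simp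

interpretation exp_law: prob_space exp_law
  by (rule prob_space_exp_law)

lemma prob_exp_law_UNIV [simp]: "measure exp_law UNIV = 1"
  using exp_law.prob_space by simp

lemma exp_law_distributed: "distributed exp_law lborel (\<lambda>x. x) (exponential_density 1)"
  by (auto simp: distributed_def exp_law_def distr_id2)

lemma exp_law_singleton: "emeasure exp_law {x} = 0"
proof -
  have "emeasure exp_law {x} = (\<integral>\<^sup>+ y. ennreal (exponential_density 1 y) * indicator {x} y \<partial>lborel)"
    unfolding exp_law_def by (rule emeasure_density) auto
  also have "\<dots> = 0"
  proof -
    have "AE y in lborel. ennreal (exponential_density 1 y) * indicator {x} y = 0"
      using AE_lborel_singleton[of x] by eventually_elim (auto split: split_indicator)
    then show ?thesis by (intro nn_integral_zero')
  qed
  finally show ?thesis .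
qed

lemma measure_exp_law_atMost: "0 \<le> y \<Longrightarrow> measure exp_law {..y} = 1 - exp (- y)"
  using exp_law.exponential_distributedD_le[OF exp_law_distributed, of y] by (simp add: atMost_def)

lemma measure_exp_law_lessThan: "0 \<le> y \<Longrightarrow> measure exp_law {..<y} = 1 - exp (- y)"
proof -
  assume y: "0 \<le> y"
  have "{..y} = {..<y} \<union> {y}" by auto
  then have "measure exp_law {..y} = measure exp_law {..<y} + measure exp_law {y}"
    using exp_law.finite_measure_Union[of "{..<y}" "{y}"] by simp
  then show ?thesis using measure_exp_law_atMost[OF y] exp_law_singleton[of y] by (simp add: measure_def)
qed

lemma AE_exp_law_pos: "AE y in exp_law. 0 < y"
proof -
  have "measure exp_law {..0} = 0" using measure_exp_law_atMost[of 0] by simp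
  then have "emeasure exp_law {..0} = 0" by (simp add: exp_law.emeasure_eq_measure)
  then show ?thesis by (intro AE_I'[of "{..0}"]) (auto simp: null_sets_def)
qed

lemma integral_exp_law:
  fixes f :: "real \<Rightarrow> 'b :: {banach, second_countable_topology}"
  assumes "f \<in> borel_measurable borel"
  shows "integral\<^sup>L exp_law f = (LINT x|lborel. exponential_density 1 x *\<^sub>R f x)"
  unfolding exp_law_def using assms by (intro integral_density) (auto simp: exponential_density_nonneg)

text \<open>Memorylessness: \<open>exp (- y)\<close> is the probability of exceeding
  \<open>y\<close>, and the excess is again standard exponential.\<close>

lemma integral_exp_law_shift:
  fixes f :: "real \<Rightarrow> complex"
  assumes [measurable]: "f \<in> borel_measurable borel" and y: "0 \<le> y"
  shows "(LINT x|exp_law. (if y < x then f x else 0)) = of_real (exp (- y)) * (LINT z|exp_law. f (y + z))"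
proof -
  have "(LINT x|exp_law. (if y < x then f x else 0)) =
      (LINT x|lborel. exponential_density 1 x *\<^sub>R (if y < x then f x else 0))"
    by (rule integral_exp_law) simp
  also have "\<dots> = (LINT z|lborel. exponential_density 1 (y + 1 * z) *\<^sub>R (if y < y + 1 * z then f (y + 1 * z) else 0))"
    by (subst lborel_integral_real_affine[where c=1 and t=y]) simp_all
  also have "\<dots> = (LINT z|lborel. exp (- y) *\<^sub>R (exponential_density 1 z *\<^sub>R f (y + z)))"
  proof (rule integral_cong_AE)
    show "AE z in lborel. exponential_density 1 (y + 1 * z) *\<^sub>R (if y < y + 1 * z then f (y + 1 * z) else 0)
        = exp (- y) *\<^sub>R (exponential_density 1 z *\<^sub>R f (y + z))"
      \<comment> \<open>At \<open>z = 0\<close> the strict inequality fails and the two integrands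
        may differ; one point has measure zero.\<close>
      using AE_lborel_singleton[of 0]
      by eventually_elim (use y in \<open>auto simp: exponential_density_def exp_add[symmetric] exp_of_real[symmetric]\<close>)
  qed simp_all
  also have "\<dots> = of_real (exp (- y)) * (LINT z|exp_law. f (y + z))"
    by (subst integral_exp_law) (simp_all add: scaleR_conv_of_real)
  finally show ?thesis .
qed

text \<open>Density, with respect to the exponential law, of the \<open>k\<close>-th largest of \<open>n\<close> exponential variables.\<close>
definition os_dens :: "nat \<Rightarrow> nat \<Rightarrow> real \<Rightarrow> real" where
  "os_dens n k y = real (n * ((n - 1) choose (k - 1))) * exp (- y) ^ (k - 1) * (1 - exp (- y)) ^ (n - k)"

lemma os_dens_measurable [measurable]: "os_dens n k \<in> borel_measurable borel"
  unfolding os_dens_def by measurable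

lemma os_dens_nonneg: "0 \<le> y \<Longrightarrow> 0 \<le> os_dens n k y"
  unfolding os_dens_def by simp

text \<open>The bound grows with \<open>n\<close>; it serves only for integrability at fixed
  \<open>n\<close>.\<close>

lemma os_dens_le: "0 \<le> y \<Longrightarrow> os_dens n k y \<le> real (n * ((n - 1) choose (k - 1)))"
proof -
  assume y: "0 \<le> y"
  have "exp (- y) ^ (k - 1) * (1 - exp (- y)) ^ (n - k) \<le> 1 * 1"
    using y by (intro mult_mono power_le_one) auto
  then show ?thesis
    using mult_left_mono[of _ 1 "real (n * ((n - 1) choose (k - 1)))"] by (simp add: os_dens_def mult.assoc)
qed

text \<open>Memorylessness applied to each of the \<open>k - 1\<close> upper factors releases
  \<open>exp (- y) ^ (k - 1)\<close>, which together with the lower factors and the number of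
  patterns is precisely \<open>os_dens\<close>.\<close>

lemma integral_exp_order_partition:
  fixes h :: "real \<Rightarrow> real \<Rightarrow> complex" and G :: "('i \<Rightarrow> real) \<Rightarrow> complex"
  assumes I: "finite I" and k: "1 \<le> k" "k \<le> card I"
    and G: "G \<in> borel_measurable (PiM I (\<lambda>_. exp_law))"
    and h: "case_prod h \<in> borel_measurable (borel \<Otimes>\<^sub>M borel)" and h1: "\<And>y x. norm (h y x) \<le> 1"
    and eq: "\<And>x j S. (\<And>i. i \<in> I \<Longrightarrow> 0 < x i) \<Longrightarrow> j \<in> I \<Longrightarrow> S \<subseteq> I - {j} \<Longrightarrow> card S = k - 1 \<Longrightarrow>
      (\<And>i. i \<in> S \<Longrightarrow> x j < x i) \<Longrightarrow> (\<And>i. i \<in> I - {j} - S \<Longrightarrow> x i < x j) \<Longrightarrow> G x = (\<Prod>i\<in>S. h (x j) (x i))"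
  shows "(LINT x|PiM I (\<lambda>_. exp_law). G x) =
    (LINT y|exp_law. of_real (os_dens (card I) k y) * (LINT z|exp_law. h y (y + z)) ^ (k - 1))"
proof -
  have [measurable]: "(\<lambda>x. h (f x) (g x)) \<in> borel_measurable K"
    if "f \<in> borel_measurable K" "g \<in> borel_measurable K" for f g and K :: "'k measure"
    using measurable_compose[OF measurable_Pair[OF that] h] by simp
  let ?c = "of_nat (card I * ((card I - 1) choose (k - 1))) :: complex"
  have "(LINT x|PiM I (\<lambda>_. exp_law). G x) = ?c *
    (LINT y|exp_law. (LINT x|exp_law. (if y < x then h y x else 0)) ^ (k - 1) * of_real (measure exp_law {..<y}) ^ (card I - k))"
    by (rule integral_order_partition[OF prob_space_exp_law sets_exp_law exp_law_singleton I k G h h1, where V = "{0<..}"])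
      (use AE_exp_law_pos in \<open>auto intro!: eq\<close>)
  also have "\<dots> = (LINT y|exp_law. ?c * ((LINT x|exp_law. (if y < x then h y x else 0)) ^ (k - 1) * of_real (measure exp_law {..<y}) ^ (card I - k)))"
    by simp
  also have "\<dots> = (LINT y|exp_law. of_real (os_dens (card I) k y) * (LINT z|exp_law. h y (y + z)) ^ (k - 1))"
  proof (rule integral_cong_AE)
    have "mono (\<lambda>y. measure exp_law {..<y})"
      by (intro monoI exp_law.finite_measure_mono) auto
    then have [measurable]: "(\<lambda>y. measure exp_law {..<y}) \<in> borel_measurable exp_law"
      by (subst measurable_cong_sets[OF sets_exp_law refl]) (rule borel_measurable_mono)
    show "(\<lambda>y. ?c * ((LINT x|exp_law. (if y < x then h y x else 0)) ^ (k - 1) * of_real (measure exp_law {..<y}) ^ (card I - k)))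
      \<in> borel_measurable exp_law" by measurable
    show "(\<lambda>y. of_real (os_dens (card I) k y) * (LINT z|exp_law. h y (y + z)) ^ (k - 1)) \<in> borel_measurable exp_law"
      by measurable
    show "AE y in exp_law. ?c * ((LINT x|exp_law. (if y < x then h y x else 0)) ^ (k - 1) * of_real (measure exp_law {..<y}) ^ (card I - k))
      = of_real (os_dens (card I) k y) * (LINT z|exp_law. h y (y + z)) ^ (k - 1)"
      using AE_exp_law_pos
    proof eventually_elim
      case (elim y)
      then show ?case
        by (subst integral_exp_law_shift)
          (auto simp: os_dens_def measure_exp_law_lessThan power_mult_distrib mult_ac)
    qed
  qed
  finally show ?thesis .
qed

lemma integrable_os_dens:
  assumes [measurable]: "f \<in> borel_measurable borel" and f: "\<And>y. 0 < y \<Longrightarrow> \<bar>f y\<bar> \<le> B"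
  shows "integrable exp_law (\<lambda>y. os_dens n k y * f y)"
proof (rule exp_law.integrable_const_bound[where B = "real (n * ((n - 1) choose (k - 1))) * B"])
  show "AE y in exp_law. norm (os_dens n k y * f y) \<le> real (n * ((n - 1) choose (k - 1))) * B"
    using AE_exp_law_pos
    by eventually_elim (use os_dens_nonneg os_dens_le f in \<open>auto simp: abs_mult intro!: mult_mono\<close>)
qed simp

text \<open>The choice \<open>h = 1\<close>, \<open>G = 1\<close> in the partition formula gives the
  normalisation without evaluating a Beta integral.\<close>

lemma integral_os_dens:
  assumes k: "1 \<le> k" "k \<le> n"
  shows "(LINT y|exp_law. os_dens n k y) = 1"
proof -
  interpret P: prob_space "PiM {1..n} (\<lambda>_. exp_law)" by (intro prob_space_PiM prob_space_exp_law)
  have "(LINT x|PiM {1..n} (\<lambda>_. exp_law). 1 :: complex) =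
    (LINT y|exp_law. of_real (os_dens (card {1..n}) k y) * (LINT z|exp_law. 1) ^ (k - 1))"
    using k by (intro integral_exp_order_partition) auto
  then have "of_real (LINT y|exp_law. os_dens n k y) = (1::complex)"
    by (simp add: P.prob_space del: One_nat_def)
  then show ?thesis by simp
qed

text \<open>Under \<open>os_dens n k\<close> the variable exp(-y) is Beta distributed with
  parameters k and n - k + 1. Multiplying by it raises \<open>k\<close> and \<open>n\<close>
  together and leaves \<open>n - k\<close> fixed, so all its moments follow from normalisation
  alone.\<close>

lemma os_dens_Suc:
  assumes k: "1 \<le> k" "k \<le> n"
  shows "os_dens n k y * exp (- y) = real k / (real n + 1) * os_dens (n + 1) (k + 1) y"
proof -
  have "real k * real (n choose k) = real n * real ((n - 1) choose (k - 1))"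
    using times_binomial_minus1_eq[of k n] k by (metis of_nat_mult Suc_le_eq One_nat_def)
  then have c: "real (n * ((n - 1) choose (k - 1))) = real k * real (n choose k)" by simp
  have e: "exp (- y) ^ k = exp (- y) ^ (k - 1) * exp (- y)"
    using k by (metis One_nat_def Suc_diff_le diff_Suc_1 power_Suc2)
  have "os_dens n k y * exp (- y) = real k * real (n choose k) * exp (- y) ^ k * (1 - exp (- y)) ^ (n - k)"
    unfolding os_dens_def c e by (simp only: mult_ac)
  also have "\<dots> = real k / (real n + 1) * ((real n + 1) * real (n choose k) * exp (- y) ^ k * (1 - exp (- y)) ^ (n - k))"
    by simp
  also have "(real n + 1) * real (n choose k) * exp (- y) ^ k * (1 - exp (- y)) ^ (n - k) = os_dens (n + 1) (k + 1) y"
    by (simp add: os_dens_def algebra_simps)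
  finally show ?thesis .
qed

lemma integral_os_dens_exp:
  assumes k: "1 \<le> k" "k \<le> n"
  shows "(LINT y|exp_law. os_dens n k y * exp (- y)) = real k / (real n + 1)"
  using integral_os_dens[of "k + 1" "n + 1"] k by (simp add: os_dens_Suc[OF k])

lemma integral_os_dens_exp2:
  assumes k: "1 \<le> k" "k \<le> n"
  shows "(LINT y|exp_law. os_dens n k y * exp (- y)^2) = real k * (real k + 1) / ((real n + 1) * (real n + 2))"
proof -
  have "os_dens n k y * exp (- y)^2 = real k / (real n + 1) * (real (k + 1) / (real (n + 1) + 1) * os_dens (n + 1 + 1) (k + 1 + 1) y)" for y
  proof -
    have "os_dens n k y * exp (- y)^2 = (os_dens n k y * exp (- y)) * exp (- y)" by (simp add: power2_eq_square)
    also have "\<dots> = real k / (real n + 1) * (os_dens (n + 1) (k + 1) y * exp (- y))"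
      unfolding os_dens_Suc[OF k] by (simp only: mult_ac)
    also have "os_dens (n + 1) (k + 1) y * exp (- y) = real (k + 1) / (real (n + 1) + 1) * os_dens (n + 1 + 1) (k + 1 + 1) y"
      by (rule os_dens_Suc) (use k in auto)
    finally show ?thesis .
  qed
  then show ?thesis
    using integral_os_dens[of "k + 1 + 1" "n + 1 + 1"] k by (simp add: add_ac)
qed

text \<open>The Chebyshev input for the concentration of the threshold at ln(n/k). Of the 3, one
  unit comes from the second moment, and at most two from centring with \<open>n\<close> where the
  mean has \<open>n + 1\<close>.\<close>

lemma integral_os_dens_deviation:
  assumes k: "1 \<le> k" "k \<le> n"
  shows "(LINT y|exp_law. os_dens n k y * (real n * exp (- y) / real k - 1)^2) \<le> 3 / real k"
proof -
  have i: "integrable exp_law (\<lambda>y. os_dens n k y * exp (- y))" "integrable exp_law (\<lambda>y. os_dens n k y * exp (- y)^2)"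
    "integrable exp_law (\<lambda>y. os_dens n k y)"
    using integrable_os_dens[of "\<lambda>y. exp (- y)" 1 n k] integrable_os_dens[of "\<lambda>y. exp (- y)^2" 1 n k] integrable_os_dens[of "\<lambda>y. 1" 1 n k]
    by (auto simp: power_le_one)
  have "(LINT y|exp_law. os_dens n k y * (real n * exp (- y) / real k - 1)^2) =
    (LINT y|exp_law. (real n / real k)^2 * (os_dens n k y * exp (- y)^2) - 2 * (real n / real k) * (os_dens n k y * exp (- y)) + os_dens n k y)"
    by (intro Bochner_Integration.integral_cong) (auto simp: power2_eq_square algebra_simps)
  also have "\<dots> = (real n / real k)^2 * (real k * (real k + 1) / ((real n + 1) * (real n + 2)))
     - 2 * (real n / real k) * (real k / (real n + 1)) + 1"
    using i by (simp add: integral_os_dens[OF k] integral_os_dens_exp[OF k] integral_os_dens_exp2[OF k])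
  also have "\<dots> \<le> 3 / real k"
  proof -
    define K N where "K = real k" and "N = real n"
    have K: "K \<ge> 1" "K \<le> N" using k by (auto simp: K_def N_def)
    have "(N / K)^2 * (K * (K + 1) / ((N + 1) * (N + 2))) = (K + 1) / K * (N\<^sup>2 / ((N + 1) * (N + 2)))"
    proof -
      have "(N / K)^2 * (K * (K + 1) / D) = (K + 1) / K * (N\<^sup>2 / D)" for D
        using K by (simp add: power2_eq_square)
      then show ?thesis .
    qed
    also have "\<dots> \<le> (K + 1) / K * 1"
    proof -
      have "N\<^sup>2 \<le> (N + 1) * (N + 2)" "0 < (N + 1) * (N + 2)"
        using K by (auto simp: power2_eq_square algebra_simps intro: add_pos_pos)
      then show ?thesis using K by (intro mult_left_mono) auto
    qed
    also have "\<dots> = 1 + 1 / K" using K by (simp add: field_simps)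
    finally have "(N / K)^2 * (K * (K + 1) / ((N + 1) * (N + 2))) \<le> 1 + 1 / K" .
    moreover have "2 * (N / K) * (K / (N + 1)) = 2 - 2 / (N + 1)"
    proof -
      have "2 * (N / K) * (K / (N + 1)) = 2 * (N / (N + 1))" using K by simp
      then show ?thesis using K by (simp add: field_simps)
    qed
    moreover have "2 / (N + 1) \<le> 2 / K" using K by (intro divide_left_mono) auto
    ultimately show ?thesis by (simp add: K_def N_def add_divide_distrib[symmetric])
  qed
  finally show ?thesis .
qed

section \<open>The quantile transform in exponential scale\<close>

text \<open>For \<open>y \<le> 0\<close> the infimum may run over an unbounded set, so the value there is set to \<open>0\<close>.\<close>
definition quantile_exp :: "(real \<Rightarrow> real) \<Rightarrow> real \<Rightarrow> real" where
  "quantile_exp F y = (if 0 < y then Inf {x. 1 - exp (- y) \<le> F x} else 0)"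

context real_distribution
begin

interpretation cdf_distribution M ..

text \<open>For positive \<open>y\<close> the level \<open>1 - exp (- y)\<close> lies strictly
  between 0 and 1, where quantile and distribution function form a Galois connection. Monotonicity
  and the image law both rest on it.\<close>

lemma quantile_exp_le_iff:
  assumes "0 < y"
  shows "quantile_exp (cdf M) y \<le> x \<longleftrightarrow> 1 - exp (- y) \<le> cdf M x"
  using pseudoinverse[of "1 - exp (- y)" x] assms by (simp add: quantile_exp_def)

lemma quantile_exp_mono:
  assumes "0 < y" "y \<le> z"
  shows "quantile_exp (cdf M) y \<le> quantile_exp (cdf M) z"
proof -
  have "1 - exp (- z) \<le> cdf M (quantile_exp (cdf M) z)"
    using assms by (subst quantile_exp_le_iff[symmetric]) auto
  then show ?thesis using assms by (subst quantile_exp_le_iff) (auto intro: order_trans[rotated])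
qed

lemma quantile_exp_measurable [measurable]: "quantile_exp (cdf M) \<in> borel_measurable borel"
\<comment> \<open>The default value 0 on the nonpositive axis can break monotonicity at 0, so the
  two half-lines are treated separately.\<close>
proof (rule borel_measurable_piecewise_mono[of "{{0<..}, {..0}}"])
  show "\<And>c. c \<in> {{0<..}, {..0}} \<Longrightarrow> mono_on c (quantile_exp (cdf M))"
    using quantile_exp_mono by (auto simp: mono_on_def quantile_exp_def[of _ "_::real"] split: if_splits)
qed auto

text \<open>Inverse transform sampling: 1 - exp(-E) is uniform. It holds for any distribution
  function, with or without atoms.\<close>

lemma distr_quantile_exp: "distr exp_law borel (quantile_exp (cdf M)) = M"
proof (rule cdf_unique)
  interpret D: prob_space "distr exp_law borel (quantile_exp (cdf M))"
    by (rule exp_law.prob_space_distr) simp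
  show rd: "real_distribution (distr exp_law borel (quantile_exp (cdf M)))"
    by standard auto
  show "real_distribution M" ..
  show "cdf (distr exp_law borel (quantile_exp (cdf M))) = cdf M"
  proof
    fix x
    have "cdf (distr exp_law borel (quantile_exp (cdf M))) x = measure exp_law {y. quantile_exp (cdf M) y \<le> x}"
      by (subst cdf_def, subst measure_distr) (simp_all add: vimage_def)
    also have "\<dots> = measure exp_law {y. 1 - exp (- y) \<le> cdf M x}"
      using AE_exp_law_pos
      by (intro exp_law.finite_measure_eq_AE) (auto elim!: eventually_mono simp: quantile_exp_le_iff)
    also have "\<dots> = cdf M x"
    proof (cases "cdf M x < 1")
      case True
      have "1 - exp (- y) \<le> cdf M x \<longleftrightarrow> y \<le> - ln (1 - cdf M x)" for y
      proof -
        have "1 - exp (- y) \<le> cdf M x \<longleftrightarrow> exp (ln (1 - cdf M x)) \<le> exp (- y)" using True by auto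
        then show ?thesis by (simp only: exp_le_cancel_iff) auto
      qed
      then have "{y. 1 - exp (- y) \<le> cdf M x} = {..- ln (1 - cdf M x)}" by auto
      moreover have "0 \<le> - ln (1 - cdf M x)" using True cdf_nonneg[of x] by (simp add: ln_le_zero_iff)
      ultimately show ?thesis using True by (simp add: measure_exp_law_atMost)
    next
      \<comment> \<open>Here the logarithm would be taken at 0; instead every \<open>y\<close>
        satisfies the inequality.\<close>
      case False
      then have "cdf M x = 1" using cdf_bounded_prob[of x] by simp
      moreover have "{y::real. 1 - exp (- y) \<le> 1} = UNIV" by auto
      ultimately show ?thesis by simp
    qed
    finally show "cdf (distr exp_law borel (quantile_exp (cdf M))) x = cdf M x" .
  qed
qed

end

section \<open>The characteristic function of the Hill sum as a mixture\<close>

text \<open>The joint law of the sample is the coordinatewise image under \<open>q\<close> of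
  independent exponentials, and for them the partition formula applies to the exponential of a sum.
  Later \<open>a\<close> is 1 / (T_n sqrt k) and \<open>d\<close> is minus the scaled
  centring.\<close>

lemma char_hill_statistic:
  fixes X :: "nat \<Rightarrow> 'a \<Rightarrow> real" and a d s :: real
  assumes "prob_space M"
    and X [measurable]: "\<And>i. X i \<in> borel_measurable M"
    and indep: "prob_space.indep_vars M (\<lambda>_. borel) X UNIV"
    and ident: "\<And>i. distr M borel (X i) = distr M borel (X 1)"
    and k: "1 \<le> k" "k \<le> n"
  defines "q \<equiv> quantile_exp (cdf (distr M borel (X 1)))"
  defines "S \<equiv> \<lambda>\<omega>. a * (\<Sum>i=1..k. ln (order_stat X n (n - i + 1) \<omega>) - ln (order_stat X n (n - k + 1) \<omega>)) + d"
  shows "char (distr M borel S) s = (LINT y|exp_law. of_real (os_dens n k y) *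
      (iexp (s * d) * (LINT z|exp_law. iexp (s * a * (ln (q (y + z)) - ln (q y)))) ^ (k - 1)))"
proof -
  interpret prob_space M by fact
  interpret D: real_distribution "distr M borel (X 1)" by (rule real_distribution_distr) simp
  have qD: "distr exp_law borel q = distr M borel (X 1)" unfolding q_def by (rule D.distr_quantile_exp)
  have [measurable]: "q \<in> borel_measurable borel" unfolding q_def by (rule D.quantile_exp_measurable)
  have q_mono: "q y \<le> q z" if "0 < y" "y \<le> z" for y z unfolding q_def by (rule D.quantile_exp_mono[OF that])
  let ?I = "{1..n}"
  let ?B = "PiM ?I (\<lambda>_. borel :: real measure)"
  define H where "H x = iexp (s * (a * (\<Sum>i=1..k. ln (order_stat (\<lambda>j x. x j) n (n - i + 1) x)
     - ln (order_stat (\<lambda>j x. x j) n (n - k + 1) x)) + d))" for x :: "nat \<Rightarrow> real"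
  have H_meas: "H \<in> borel_measurable ?B"
  proof -
    have [measurable]: "order_stat (\<lambda>j x. x j) n i \<in> borel_measurable ?B" for i
      by (rule order_stat_measurable) (rule measurable_component_singleton)
    show ?thesis unfolding H_def by measurable
  qed
  have S_meas [measurable]: "S \<in> borel_measurable M" unfolding S_def by measurable
  \<comment> \<open>Points of the product space are undefined outside \<open>{1..n}\<close>; order
    statistics read only coordinates inside.\<close>
  have restr: "order_stat (\<lambda>j x. x j) n i (restrict x ?I) = order_stat (\<lambda>j x. x j) n i x" for i x
    unfolding order_stat_def by (intro arg_cong2[where f=nth] arg_cong[where f=sort] map_cong refl) (auto simp del: upt_Suc)
  have osX: "order_stat X n i \<omega> = order_stat (\<lambda>j x. x j) n i (\<lambda>i\<in>?I. X i \<omega>)" for i \<omega>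
    unfolding restr by (simp add: order_stat_def)
  have cq [measurable]: "compose ?I q \<in> PiM ?I (\<lambda>_. exp_law) \<rightarrow>\<^sub>M ?B"
    unfolding compose_def by measurable
  have "char (distr M borel S) s = (LINT \<omega>|M. iexp (s * S \<omega>))"
    unfolding char_def by (rule integral_distr) simp_all
  also have "\<dots> = (LINT \<omega>|M. H (\<lambda>i\<in>?I. X i \<omega>))"
    unfolding S_def H_def osX ..
  also have "\<dots> = (LINT x|distr M ?B (\<lambda>\<omega>. \<lambda>i\<in>?I. X i \<omega>). H x)"
    by (rule integral_distr[symmetric]) (use H_meas in measurable)
  also have "distr M ?B (\<lambda>\<omega>. \<lambda>i\<in>?I. X i \<omega>) = PiM ?I (\<lambda>i. distr M borel (X i))"
    using k indep_vars_subset[OF indep, of ?I]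
    by (subst indep_vars_iff_distr_eq_PiM[symmetric]) auto
  \<comment> \<open>The target of the image measure is written as a probability space so that
    product and image can be exchanged; only its sigma-algebra matters, and it is changed back to
    \<open>borel\<close> afterwards.\<close>
  also have "\<dots> = PiM ?I (\<lambda>i. distr exp_law (distr M borel (X 1)) q)"
  proof (intro PiM_cong refl)
    show "distr M borel (X i) = distr exp_law (distr M borel (X 1)) q" for i
      unfolding ident[of i] qD[symmetric] by (intro distr_cong) auto
  qed
  also have "\<dots> = distr (PiM ?I (\<lambda>_. exp_law)) (PiM ?I (\<lambda>_. distr M borel (X 1))) (compose ?I q)"
    by (rule distr_PiM_finite_prob_space'[symmetric])
      (auto intro!: prob_space_exp_law prob_space_distr)
  also have "\<dots> = distr (PiM ?I (\<lambda>_. exp_law)) ?B (compose ?I q)"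
    by (intro distr_cong sets_PiM_cong) auto
  also have "(LINT x|distr (PiM ?I (\<lambda>_. exp_law)) ?B (compose ?I q). H x) = (LINT x|PiM ?I (\<lambda>_. exp_law). H (compose ?I q x))"
    by (rule integral_distr[OF cq H_meas])
  \<comment> \<open>The constant phase is divided out so that the integrand is a pure product over
    the exceedances.\<close>
  also have "\<dots> = (LINT x|PiM ?I (\<lambda>_. exp_law). iexp (s * d) * (H (compose ?I q x) / iexp (s * d)))"
    by simp
  also have "\<dots> = iexp (s * d) * (LINT x|PiM ?I (\<lambda>_. exp_law). H (compose ?I q x) / iexp (s * d))"
    by (rule integral_mult_right_zero)
  also have "(LINT x|PiM ?I (\<lambda>_. exp_law). H (compose ?I q x) / iexp (s * d)) =
    (LINT y|exp_law. of_real (os_dens (card ?I) k y) * (LINT z|exp_law. iexp (s * a * (ln (q (y + z)) - ln (q y)))) ^ (k - 1))"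
  proof (rule integral_exp_order_partition)
    show "(\<lambda>x. H (compose ?I q x) / iexp (s * d)) \<in> borel_measurable (PiM ?I (\<lambda>_. exp_law))"
      using measurable_compose[OF cq H_meas] by measurable
    show "(\<lambda>(y, x). iexp (s * a * (ln (q x) - ln (q y)))) \<in> borel_measurable (borel \<Otimes>\<^sub>M borel)"
      by measurable
    fix x :: "nat \<Rightarrow> real" and j U
    assume pos: "\<And>i. i \<in> ?I \<Longrightarrow> 0 < x i" and j: "j \<in> ?I" and U: "U \<subseteq> ?I - {j}" "card U = k - 1"
      and above: "\<And>i. i \<in> U \<Longrightarrow> x j < x i" and below: "\<And>i. i \<in> ?I - {j} - U \<Longrightarrow> x i < x j"
    have "(\<Sum>i=1..k. ln (order_stat (\<lambda>j x. x j) n (n - i + 1) (compose ?I q x)) - ln (order_stat (\<lambda>j x. x j) n (n - k + 1) (compose ?I q x)))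
       = (\<Sum>i\<in>U. ln (compose ?I q x i) - ln (compose ?I q x j))"
    proof (rule sum_order_stat_above[where j = j and S = U and X = "\<lambda>j x. x j"])
      show "compose ?I q x j \<le> compose ?I q x i" if "i \<in> U" for i
        using that U j above[of i] pos[of j] by (auto simp: compose_def subset_eq intro!: q_mono)
      show "compose ?I q x i \<le> compose ?I q x j" if "i \<in> ?I - {j} - U" for i
        using that j below[of i] pos[of i] by (auto simp: compose_def intro!: q_mono)
    qed (use j U k in auto)
    also have "\<dots> = (\<Sum>i\<in>U. ln (q (x i)) - ln (q (x j)))"
      using U j by (intro sum.cong) (auto simp: compose_def)
    finally have "H (compose ?I q x) = iexp (s * d) * iexp (\<Sum>i\<in>U. s * a * (ln (q (x i)) - ln (q (x j))))"
      unfolding H_def by (simp add: exp_add[symmetric] algebra_simps sum_distrib_left)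
    also have "iexp (\<Sum>i\<in>U. s * a * (ln (q (x i)) - ln (q (x j)))) = (\<Prod>i\<in>U. iexp (s * a * (ln (q (x i)) - ln (q (x j)))))"
    proof -
      have "finite U" using U(1) by (rule finite_subset) simp
      then show ?thesis by (simp add: exp_sum sum_distrib_left)
    qed
    finally show "H (compose ?I q x) / iexp (s * d) = (\<Prod>i\<in>U. iexp (s * a * (ln (q (x i)) - ln (q (x j)))))"
      by simp
  qed (use k in auto)
  finally show ?thesis
    by (subst (asm) integral_mult_right_zero[symmetric]) (simp add: mult_ac)
qed

section \<open>Second-order regular variation\<close>

lemma K_rho_eq:
  assumes "1 \<le> u"
  shows "K_rho \<rho> u = (if \<rho> = 0 then ln u else (u powr \<rho> - 1) / \<rho>)"
proof -
  let ?F = "\<lambda>u. if \<rho> = 0 then ln u else (u powr \<rho> - 1) / \<rho>"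
  have "(LBINT x=ereal 1..ereal u. x powr (\<rho> - 1)) = ?F u - ?F 1"
  proof (rule interval_integral_FTC_finite)
    show "continuous_on {min 1 u..max 1 u} (\<lambda>x. x powr (\<rho> - 1))"
      using assms by (intro continuous_intros) auto
    show "(?F has_vector_derivative x powr (\<rho> - 1)) (at x within {min 1 u..max 1 u})"
      if "min 1 u \<le> x" "x \<le> max 1 u" for x
    proof (cases "\<rho> = 0")
      case True
      then show ?thesis using that assms
        by (auto intro!: derivative_eq_intros simp: has_real_derivative_iff_has_vector_derivative[symmetric] powr_minus field_simps)
    next
      case False
      then show ?thesis using that assms
        by (auto intro!: derivative_eq_intros simp: has_real_derivative_iff_has_vector_derivative[symmetric])
    qed
  qed
  then show ?thesis by (simp add: K_rho_def one_ereal_def)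
qed

lemma K_rho_1 [simp]: "K_rho \<rho> 1 = 0"
  by (simp add: K_rho_eq)

text \<open>Substitution in the defining integral. This cocycle identity is what forces
  \<open>b\<close> to vary regularly with index \<open>\<rho>\<close>.\<close>

lemma K_rho_mult:
  assumes "1 \<le> l" "1 \<le> u"
  shows "K_rho \<rho> (u * l) - K_rho \<rho> l = l powr \<rho> * K_rho \<rho> u"
proof -
  have "1 \<le> u * l" using assms mult_mono[of 1 u 1 l] by simp
  then show ?thesis using assms
    by (simp add: K_rho_eq ln_mult powr_mult field_simps)
qed

lemma K_rho_mean_value:
  assumes "1 < l"
  obtains x where "1 < x" "x < l" "K_rho \<rho> l = (l - 1) * x powr (\<rho> - 1)"
proof -
  let ?F = "\<lambda>u. if \<rho> = 0 then ln u else (u powr \<rho> - 1) / \<rho>"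
  have "\<exists>x. 1 < x \<and> x < l \<and> ?F l - ?F 1 = (l - 1) * x powr (\<rho> - 1)"
  proof (rule MVT2[OF assms])
    show "(?F has_real_derivative x powr (\<rho> - 1)) (at x)" if "1 \<le> x" "x \<le> l" for x
    proof (cases "\<rho> = 0")
      case True
      then show ?thesis using that by (auto intro!: derivative_eq_intros simp: powr_minus field_simps)
    next
      case False
      then show ?thesis using that by (auto intro!: derivative_eq_intros)
    qed
  qed
  then show ?thesis using that assms by (cases "\<rho> = 0") (auto simp: K_rho_eq)
qed

lemma K_rho_pos:
  assumes "1 < l"
  shows "0 < K_rho \<rho> l"
proof -
  obtain x where "1 < x" "K_rho \<rho> l = (l - 1) * x powr (\<rho> - 1)"
    using K_rho_mean_value[OF assms, of \<rho>] by metis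
  then show ?thesis using assms by simp
qed

lemma K_rho_nonneg: "1 \<le> l \<Longrightarrow> 0 \<le> K_rho \<rho> l"
  using K_rho_pos[of l \<rho>] by (cases "l = 1") auto

lemma K_rho_le:
  assumes "\<rho> \<le> 0" "1 \<le> l"
  shows "K_rho \<rho> l \<le> l - 1"
proof (cases "l = 1")
  case False
  then obtain x where x: "1 < x" "x < l" "K_rho \<rho> l = (l - 1) * x powr (\<rho> - 1)"
    using K_rho_mean_value[of l \<rho>] assms by auto
  have "x powr (\<rho> - 1) \<le> x powr 0" using x assms by (intro powr_mono) auto
  then show ?thesis using x mult_left_mono[of "x powr (\<rho> - 1)" 1 "l - 1"] by simp
qed simp

text \<open>The integrand stays above 1 - (1 - rho)(l - 1), by exp(v) >= 1 + v and ln x <= l - 1.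
  With the upper bound l - 1, the kernel is linear near 1 up to a quadratic error.\<close>

lemma K_rho_ge:
  assumes "\<rho> \<le> 0" "1 \<le> l"
  shows "(l - 1) - (1 - \<rho>) * (l - 1)\<^sup>2 \<le> K_rho \<rho> l"
proof (cases "l = 1")
  case False
  then obtain x where x: "1 < x" "x < l" "K_rho \<rho> l = (l - 1) * x powr (\<rho> - 1)"
    using K_rho_mean_value[of l \<rho>] assms by auto
  have "ln x \<le> l - 1" using ln_le_minus_one[of x] x by simp
  then have "1 - (1 - \<rho>) * (l - 1) \<le> 1 + (\<rho> - 1) * ln x"
    using mult_left_mono[of "ln x" "l - 1" "1 - \<rho>"] assms by (simp add: algebra_simps)
  also have "\<dots> \<le> x powr (\<rho> - 1)" using x exp_ge_add_one_self[of "(\<rho> - 1) * ln x"] by (simp add: powr_def)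
  finally have "(l - 1) * (1 - (1 - \<rho>) * (l - 1)) \<le> K_rho \<rho> l"
    unfolding x(3) using x by (intro mult_left_mono) auto
  then show ?thesis by (simp add: power2_eq_square algebra_simps)
qed simp

section \<open>Regular variation of \<open>b\<close> and bounds on ratios of
  \<open>L\<close>\<close>

context
  fixes L b :: "real \<Rightarrow> real" and \<rho> :: real
  assumes \<rho>: "\<rho> \<le> 0"
    and L_pos: "\<forall>\<^sub>F x in at_top. L x > 0"
    and A2: "\<And>\<Lambda> \<epsilon>. \<Lambda> \<ge> 1 \<Longrightarrow> \<epsilon> > 0 \<Longrightarrow>
       \<forall>\<^sub>F x in at_top. \<forall>u\<in>{1..\<Lambda>}.
          \<bar>ln (L (u * x) / L x) - b x * K_rho \<rho> u\<bar> \<le> \<epsilon> * \<bar>b x * K_rho \<rho> u\<bar>"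
begin

lemma A2_ge:
  assumes "\<Lambda> \<ge> 1" "\<epsilon> > 0"
  obtains x1 where "x1 > 0" "\<And>x. x \<ge> x1 \<Longrightarrow> L x > 0"
    "\<And>x u. x \<ge> x1 \<Longrightarrow> 1 \<le> u \<Longrightarrow> u \<le> \<Lambda> \<Longrightarrow>
      \<bar>ln (L (u * x) / L x) - b x * K_rho \<rho> u\<bar> \<le> \<epsilon> * (\<bar>b x\<bar> * K_rho \<rho> u)"
proof -
  have "\<forall>\<^sub>F x in at_top. x > 0 \<and> L x > 0 \<and> (\<forall>u\<in>{1..\<Lambda>}.
      \<bar>ln (L (u * x) / L x) - b x * K_rho \<rho> u\<bar> \<le> \<epsilon> * (\<bar>b x\<bar> * K_rho \<rho> u))"
    using A2[OF assms] L_pos eventually_gt_at_top[of 0]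
    by eventually_elim (auto simp: abs_mult K_rho_nonneg)
  then obtain x1 where "\<forall>x\<ge>x1. x > 0 \<and> L x > 0 \<and> (\<forall>u\<in>{1..\<Lambda>}.
      \<bar>ln (L (u * x) / L x) - b x * K_rho \<rho> u\<bar> \<le> \<epsilon> * (\<bar>b x\<bar> * K_rho \<rho> u))"
    unfolding eventually_at_top_linorder by blast
  then show ?thesis using that[of x1] by auto
qed

text \<open>ln(L(2lx) / L x) is expanded once from \<open>x\<close> directly and once through the
  intermediate point \<open>l * x\<close>. Equating the two and applying the cocycle identity
  isolates b(lx) - l^rho b(x). The factors reach 4 because \<open>2 * l \<le> 4\<close>. The error
  still contains b(lx) itself.\<close>

lemma b_regular_variation_aux:
  assumes \<eta>: "0 < \<eta>"
  shows "\<forall>\<^sub>F x in at_top. \<forall>l\<in>{1..2}. \<bar>b (l * x) - l powr \<rho> * b x\<bar> \<le> \<eta> * \<bar>b (l * x)\<bar> + \<eta> * (6 / K_rho \<rho> 2) * \<bar>b x\<bar>"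
proof -
  obtain x1 where x1: "x1 > 0" "\<And>x. x \<ge> x1 \<Longrightarrow> L x > 0"
    and A: "\<And>x u. x \<ge> x1 \<Longrightarrow> 1 \<le> u \<Longrightarrow> u \<le> 4 \<Longrightarrow>
      \<bar>ln (L (u * x) / L x) - b x * K_rho \<rho> u\<bar> \<le> \<eta> * (\<bar>b x\<bar> * K_rho \<rho> u)"
    using A2_ge[of 4 \<eta>] \<eta> by auto
  have K2: "0 < K_rho \<rho> 2" by (rule K_rho_pos) simp
  have "\<bar>b (l * x) - l powr \<rho> * b x\<bar> \<le> \<eta> * \<bar>b (l * x)\<bar> + \<eta> * (6 / K_rho \<rho> 2) * \<bar>b x\<bar>"
    if x: "x \<ge> x1" and l: "1 \<le> l" "l \<le> 2" for x l
  proof -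
    have lx: "l * x \<ge> x1" using x l x1(1) mult_right_mono[of 1 l x] by linarith
    have l2x: "2 * l * x \<ge> x1" using x l x1(1) mult_right_mono[of 1 "2 * l" x] by linarith
    have pos: "L x > 0" "L (l * x) > 0" "L (2 * l * x) > 0" using x1 x lx l2x by auto
    have split: "ln (L (2 * l * x) / L x) = ln (L (2 * (l * x)) / L (l * x)) + ln (L (l * x) / L x)"
      using pos by (simp add: ln_div mult.assoc)
    have 1: "\<bar>ln (L (2 * l * x) / L x) - b x * K_rho \<rho> (2 * l)\<bar> \<le> \<eta> * (\<bar>b x\<bar> * K_rho \<rho> (2 * l))"
      using A[of x "2 * l"] x l by simp
    have 2: "\<bar>ln (L (2 * (l * x)) / L (l * x)) - b (l * x) * K_rho \<rho> 2\<bar> \<le> \<eta> * (\<bar>b (l * x)\<bar> * K_rho \<rho> 2)"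
      using A[of "l * x" 2] lx by simp
    have 3: "\<bar>ln (L (l * x) / L x) - b x * K_rho \<rho> l\<bar> \<le> \<eta> * (\<bar>b x\<bar> * K_rho \<rho> l)"
      using A[of x l] x l by simp
    have K: "K_rho \<rho> (2 * l) - K_rho \<rho> l = l powr \<rho> * K_rho \<rho> 2" using K_rho_mult[of l 2 \<rho>] l by simp
    \<comment> \<open>The sum is at most (2l - 1) + (l - 1); 6 is a convenient upper bound.\<close>
    have Kb: "K_rho \<rho> (2 * l) + K_rho \<rho> l \<le> 6"
      using K_rho_le[OF \<rho>, of "2 * l"] K_rho_le[OF \<rho>, of l] l by linarith
    have "\<bar>b (l * x) * K_rho \<rho> 2 - b x * (K_rho \<rho> (2 * l) - K_rho \<rho> l)\<bar>
      \<le> \<eta> * (\<bar>b (l * x)\<bar> * K_rho \<rho> 2) + \<eta> * (\<bar>b x\<bar> * (K_rho \<rho> (2 * l) + K_rho \<rho> l))"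
      using 1 2 3 unfolding split distrib_left right_diff_distrib by linarith
    also have "\<dots> \<le> \<eta> * (\<bar>b (l * x)\<bar> * K_rho \<rho> 2) + \<eta> * (\<bar>b x\<bar> * 6)"
      using Kb \<eta> by (intro add_left_mono mult_left_mono) auto
    also have "\<dots> = (\<eta> * \<bar>b (l * x)\<bar> + \<eta> * (6 / K_rho \<rho> 2) * \<bar>b x\<bar>) * K_rho \<rho> 2"
      using K2 by (simp add: field_simps)
    also have "\<bar>b (l * x) * K_rho \<rho> 2 - b x * (K_rho \<rho> (2 * l) - K_rho \<rho> l)\<bar> = \<bar>b (l * x) - l powr \<rho> * b x\<bar> * K_rho \<rho> 2"
      unfolding K using K2 by (subst abs_mult_pos) (auto simp: algebra_simps)
    finally show ?thesis using K2 by simp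
  qed
  then show ?thesis unfolding eventually_at_top_linorder by (intro exI[of _ x1]) auto
qed

text \<open>The error in b(lx) is absorbed: a small \<open>\<eta>\<close> first yields the a priori
  bound |b(lx)| <= 2 |b(x)|, and inserting it leaves an error in b(x) alone.\<close>

lemma b_regular_variation:
  assumes \<epsilon>: "0 < \<epsilon>"
  shows "\<forall>\<^sub>F x in at_top. \<forall>l\<in>{1..2}. \<bar>b (l * x) - l powr \<rho> * b x\<bar> \<le> \<epsilon> * \<bar>b x\<bar>"
proof -
  define D where "D = 6 / K_rho \<rho> 2"
  have D: "0 < D" unfolding D_def using K_rho_pos[of 2 \<rho>] by simp
  \<comment> \<open>The first two entries of the minimum give the a priori bound; the third makes
    \<eta> (2 + D) at most \<epsilon> after inserting it.\<close>
  define \<eta> where "\<eta> = min (1/4) (min (1 / (4 * D)) (\<epsilon> / (2 + D)))"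
  have \<eta>: "0 < \<eta>" using D \<epsilon> by (simp add: \<eta>_def)
  have \<eta>': "\<eta> \<le> 1/4" "\<eta> \<le> 1 / (4 * D)" "\<eta> \<le> \<epsilon> / (2 + D)" by (simp_all only: \<eta>_def min.cobounded1 min.coboundedI2)
  have \<eta>D: "\<eta> * D \<le> 1/4" "\<eta> * (2 + D) \<le> \<epsilon>" using \<eta> \<eta>' D by (auto simp: field_simps)
  show ?thesis
    using b_regular_variation_aux[OF \<eta>] unfolding D_def[symmetric]
  proof eventually_elim
    case (elim x)
    show ?case
    proof
      fix l :: real assume l: "l \<in> {1..2}"
      have *: "\<bar>b (l * x) - l powr \<rho> * b x\<bar> \<le> \<eta> * \<bar>b (l * x)\<bar> + \<eta> * D * \<bar>b x\<bar>"
        using elim l by auto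
      have "l powr \<rho> \<le> l powr 0" using l \<rho> by (intro powr_mono) auto
      then have "\<bar>l powr \<rho> * b x\<bar> \<le> \<bar>b x\<bar>" using l by (simp add: abs_mult mult_left_le_one_le)
      moreover have "\<eta> * \<bar>b (l * x)\<bar> \<le> 1/4 * \<bar>b (l * x)\<bar>" "\<eta> * D * \<bar>b x\<bar> \<le> 1/4 * \<bar>b x\<bar>"
        using \<eta>' \<eta>D by (intro mult_right_mono; simp)+
      ultimately have "\<bar>b (l * x)\<bar> \<le> 2 * \<bar>b x\<bar>" using * by linarith
      then have "\<eta> * \<bar>b (l * x)\<bar> \<le> \<eta> * (2 * \<bar>b x\<bar>)" using \<eta> by (intro mult_left_mono) auto
      then have "\<bar>b (l * x) - l powr \<rho> * b x\<bar> \<le> \<eta> * (2 + D) * \<bar>b x\<bar>" using * by (simp add: algebra_simps)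
      also have "\<dots> \<le> \<epsilon> * \<bar>b x\<bar>" using \<eta>D by (intro mult_right_mono) auto
      finally show "\<bar>b (l * x) - l powr \<rho> * b x\<bar> \<le> \<epsilon> * \<bar>b x\<bar>" .
    qed
  qed
qed

lemma b_ratio_near_1:
  assumes \<epsilon>: "0 < \<epsilon>"
  obtains \<delta> where "0 < \<delta>" "\<forall>\<^sub>F x in at_top. \<forall>l\<in>{1..1+\<delta>}. \<bar>b (l * x) - b x\<bar> \<le> \<epsilon> * \<bar>b x\<bar>"
proof -
  have "((\<lambda>l. l powr \<rho>) \<longlongrightarrow> 1 powr \<rho>) (nhds 1)" by (intro tendsto_intros filterlim_ident) auto
  then have "\<forall>\<^sub>F l in nhds 1. dist (l powr \<rho>) 1 < \<epsilon> / 2"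
    using \<epsilon> by (intro tendstoD) auto
  then obtain \<delta> where \<delta>: "0 < \<delta>" "\<And>l. dist l 1 < \<delta> \<Longrightarrow> dist (l powr \<rho>) 1 < \<epsilon> / 2"
    unfolding eventually_nhds_metric by blast
  \<comment> \<open>Halving \<open>\<delta>\<close> gives the strict distance needed for continuity
    of l^rho at 1; the cap 1 keeps \<open>l\<close> in the range of
    \<open>b_regular_variation\<close>.\<close>
  have "\<forall>\<^sub>F x in at_top. \<forall>l\<in>{1..1 + min (\<delta> / 2) 1}. \<bar>b (l * x) - b x\<bar> \<le> \<epsilon> * \<bar>b x\<bar>"
    using b_regular_variation[OF half_gt_zero[OF \<epsilon>]]
  proof (eventually_elim, intro ballI)
    fix x l assume *: "\<forall>l\<in>{1..2}. \<bar>b (l * x) - l powr \<rho> * b x\<bar> \<le> \<epsilon> / 2 * \<bar>b x\<bar>" and l: "l \<in> {1..1 + min (\<delta> / 2) 1}"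
    have "\<bar>l powr \<rho> - 1\<bar> \<le> \<epsilon> / 2" 
    proof -
      have "dist l 1 < \<delta>" using \<delta>(1) l min.cobounded1[of "\<delta> / 2" 1] unfolding dist_real_def atLeastAtMost_iff by linarith
      from \<delta>(2)[OF this] show ?thesis by (simp add: dist_real_def)
    qed
    then have "\<bar>l powr \<rho> * b x - b x\<bar> \<le> \<epsilon> / 2 * \<bar>b x\<bar>"
      using mult_right_mono[of "\<bar>l powr \<rho> - 1\<bar>" "\<epsilon> / 2" "\<bar>b x\<bar>"] by (simp add: abs_mult[symmetric] algebra_simps)
    moreover have "\<bar>b (l * x) - l powr \<rho> * b x\<bar> \<le> \<epsilon> / 2 * \<bar>b x\<bar>" using * l by auto
    moreover have "\<epsilon> / 2 * \<bar>b x\<bar> + \<epsilon> / 2 * \<bar>b x\<bar> = \<epsilon> * \<bar>b x\<bar>" by simp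
    ultimately show "\<bar>b (l * x) - b x\<bar> \<le> \<epsilon> * \<bar>b x\<bar>" by linarith
  qed
  then show ?thesis using \<delta>(1) by (intro that[of "min (\<delta> / 2) 1"]) auto
qed

text \<open>Dyadic induction on the factor \<open>l\<close>. One doubling raises |b| by at most 3/2,
  less than the factor 2 by which \<open>l\<close> shrinks, so the tail costs 4 (l/2) (3/2) = 3l.
  The first doubling costs 2, which is below l once l > 2, and the total is again 4l.\<close>

lemma ln_L_ratio_growth:
  "\<forall>\<^sub>F x in at_top. \<forall>l\<ge>1. \<bar>ln (L (l * x) / L x)\<bar> \<le> 4 * l * \<bar>b x\<bar>"
proof -
  obtain x1 where x1: "x1 > 0" "\<And>x. x \<ge> x1 \<Longrightarrow> L x > 0"
    and A: "\<And>x u. x \<ge> x1 \<Longrightarrow> 1 \<le> u \<Longrightarrow> u \<le> 2 \<Longrightarrow>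
      \<bar>ln (L (u * x) / L x) - b x * K_rho \<rho> u\<bar> \<le> 1 * (\<bar>b x\<bar> * K_rho \<rho> u)"
    using A2_ge[of 2 1] by auto
  have "\<forall>\<^sub>F x in at_top. \<bar>b (2 * x)\<bar> \<le> 3/2 * \<bar>b x\<bar>"
    using b_regular_variation[OF half_gt_zero[OF zero_less_one]]
  proof eventually_elim
    fix x assume "\<forall>l\<in>{1..2}. \<bar>b (l * x) - l powr \<rho> * b x\<bar> \<le> 1/2 * \<bar>b x\<bar>"
    then have "\<bar>b (2 * x) - 2 powr \<rho> * b x\<bar> \<le> 1/2 * \<bar>b x\<bar>" by auto
    moreover have "2 powr \<rho> \<le> 2 powr (0::real)" using \<rho> by (intro powr_mono) auto
    then have "\<bar>2 powr \<rho> * b x\<bar> \<le> \<bar>b x\<bar>" by (simp add: abs_mult mult_left_le_one_le)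
    ultimately show "\<bar>b (2 * x)\<bar> \<le> 3/2 * \<bar>b x\<bar>" by linarith
  qed
  then obtain x2 where x2: "\<And>x. x \<ge> x2 \<Longrightarrow> \<bar>b (2 * x)\<bar> \<le> 3/2 * \<bar>b x\<bar>"
    unfolding eventually_at_top_linorder by blast
  have small: "\<bar>ln (L (l * x) / L x)\<bar> \<le> 2 * (l - 1) * \<bar>b x\<bar>" if "x \<ge> x1" "1 \<le> l" "l \<le> 2" for x l
  proof -
    have "\<bar>ln (L (l * x) / L x)\<bar> \<le> 2 * (\<bar>b x\<bar> * K_rho \<rho> l)"
      using A[OF that] abs_mult[of "b x" "K_rho \<rho> l"] K_rho_nonneg[of l \<rho>] that by simp
    also have "\<dots> \<le> 2 * (\<bar>b x\<bar> * (l - 1))" using K_rho_le[OF \<rho>, of l] that by (intro mult_left_mono) auto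
    finally show ?thesis by (simp add: mult_ac)
  qed
  have "\<bar>ln (L (l * x) / L x)\<bar> \<le> 4 * l * \<bar>b x\<bar>" if "x \<ge> max x1 x2" "1 \<le> l" "l \<le> 2 ^ n" for x l n
    using that
  proof (induction n arbitrary: x l)
    case 0
    then show ?case using x1(2)[of x] by simp
  next
    case (Suc n)
    show ?case
    proof (cases "l \<le> 2")
      case True
      have "2 * (l - 1) * \<bar>b x\<bar> \<le> 4 * l * \<bar>b x\<bar>" using Suc.prems by (intro mult_right_mono) auto
      then show ?thesis using small[of x l] Suc.prems True by auto
    next
      case False
      have "1 * x \<le> l * x" using Suc.prems x1(1) by (intro mult_right_mono) auto
      then have x: "2 * x \<ge> max x1 x2" "l * x \<ge> x1" using Suc.prems x1(1) by linarith+
      have pos: "L x > 0" "L (2 * x) > 0" "L (l * x) > 0" using x x1(2) Suc.prems by auto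
      have "ln (L (l * x) / L x) = ln (L ((l / 2) * (2 * x)) / L (2 * x)) + ln (L (2 * x) / L x)"
        using pos by (simp add: ln_div)
      moreover have "\<bar>ln (L ((l / 2) * (2 * x)) / L (2 * x))\<bar> \<le> 4 * (l / 2) * \<bar>b (2 * x)\<bar>"
        using x Suc.prems False by (intro Suc.IH) auto
      moreover have "4 * (l / 2) * \<bar>b (2 * x)\<bar> \<le> 4 * (l / 2) * (3/2 * \<bar>b x\<bar>)"
        using x2[of x] Suc.prems by (intro mult_left_mono) auto
      moreover have "\<bar>ln (L (2 * x) / L x)\<bar> \<le> 2 * \<bar>b x\<bar>" using small[of x 2] Suc.prems by simp
      moreover have "2 * \<bar>b x\<bar> \<le> l * \<bar>b x\<bar>" using False by (intro mult_right_mono) auto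
      moreover have "4 * (l / 2) * (3/2 * \<bar>b x\<bar>) = 3 * (l * \<bar>b x\<bar>)" "4 * l * \<bar>b x\<bar> = 4 * (l * \<bar>b x\<bar>)" by simp_all
      ultimately show ?thesis by linarith
    qed
  qed
  moreover have "\<exists>n. l \<le> 2 ^ n" for l :: real
    using real_arch_pow[of 2 l] by (auto intro: less_imp_le)
  ultimately have "\<forall>x\<ge>max x1 x2. \<forall>l\<ge>1. \<bar>ln (L (l * x) / L x)\<bar> \<le> 4 * l * \<bar>b x\<bar>" by blast
  then show ?thesis unfolding eventually_at_top_linorder by blast
qed

text \<open>Second-order Potter bound. Only local uniformity is assumed, but the extreme order statistics
  need all \<open>l \<ge> 1\<close>.\<close>
lemma ln_L_ratio_expansion:
  assumes \<epsilon>: "0 < \<epsilon>"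
  shows "\<forall>\<^sub>F x in at_top. \<forall>l\<ge>1. \<bar>ln (L (l * x) / L x) - b x * (l - 1)\<bar> \<le> \<bar>b x\<bar> * (\<epsilon> * (l - 1) + (11 - \<rho>) * (l - 1)\<^sup>2)"
proof -
  have "\<forall>\<^sub>F x in at_top. \<forall>u\<in>{1..2}. \<bar>ln (L (u * x) / L x) - b x * K_rho \<rho> u\<bar> \<le> \<epsilon> * \<bar>b x * K_rho \<rho> u\<bar>"
    using \<epsilon> by (intro A2) auto
  with ln_L_ratio_growth show ?thesis
  proof eventually_elim
    fix x assume g: "\<forall>l\<ge>1. \<bar>ln (L (l * x) / L x)\<bar> \<le> 4 * l * \<bar>b x\<bar>"
      and A: "\<forall>u\<in>{1..2}. \<bar>ln (L (u * x) / L x) - b x * K_rho \<rho> u\<bar> \<le> \<epsilon> * \<bar>b x * K_rho \<rho> u\<bar>"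
    show "\<forall>l\<ge>1. \<bar>ln (L (l * x) / L x) - b x * (l - 1)\<bar> \<le> \<bar>b x\<bar> * (\<epsilon> * (l - 1) + (11 - \<rho>) * (l - 1)\<^sup>2)"
    proof (intro allI impI)
      fix l :: real assume l: "1 \<le> l"
      show "\<bar>ln (L (l * x) / L x) - b x * (l - 1)\<bar> \<le> \<bar>b x\<bar> * (\<epsilon> * (l - 1) + (11 - \<rho>) * (l - 1)\<^sup>2)"
      \<comment> \<open>Up to 2 the local assumption applies and \<open>K_rho\<close> is replaced by
        \<open>l - 1\<close>; beyond 2 the growth bound is enough, since there the quadratic term
        dominates.\<close>
      proof (cases "l \<le> 2")
        case True
        have "\<bar>ln (L (l * x) / L x) - b x * K_rho \<rho> l\<bar> \<le> \<epsilon> * \<bar>b x * K_rho \<rho> l\<bar>" using A l True by auto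
        also have "\<dots> = \<bar>b x\<bar> * (\<epsilon> * K_rho \<rho> l)" using l by (simp add: abs_mult K_rho_nonneg)
        also have "\<dots> \<le> \<bar>b x\<bar> * (\<epsilon> * (l - 1))" using K_rho_le[OF \<rho> l] \<epsilon> by (intro mult_left_mono) auto
        finally have 1: "\<bar>ln (L (l * x) / L x) - b x * K_rho \<rho> l\<bar> \<le> \<bar>b x\<bar> * (\<epsilon> * (l - 1))" .
        have "\<bar>K_rho \<rho> l - (l - 1)\<bar> \<le> (1 - \<rho>) * (l - 1)\<^sup>2"
          using K_rho_le[OF \<rho> l] K_rho_ge[OF \<rho> l] by linarith
        also have "\<dots> \<le> (11 - \<rho>) * (l - 1)\<^sup>2" by (intro mult_right_mono) auto
        finally have "\<bar>b x * K_rho \<rho> l - b x * (l - 1)\<bar> \<le> \<bar>b x\<bar> * ((11 - \<rho>) * (l - 1)\<^sup>2)"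
          unfolding right_diff_distrib[symmetric] abs_mult by (intro mult_left_mono) auto
        then show ?thesis using 1 unfolding distrib_left by linarith
      next
        case False
        have "\<bar>ln (L (l * x) / L x) - b x * (l - 1)\<bar> \<le> 4 * l * \<bar>b x\<bar> + \<bar>b x\<bar> * (l - 1)"
          using g[rule_format, OF l] abs_mult[of "b x" "l - 1"] l by simp
        also have "\<dots> = \<bar>b x\<bar> * (5 * l - 1)" by (simp add: algebra_simps)
        also have "\<dots> \<le> \<bar>b x\<bar> * (\<epsilon> * (l - 1) + (11 - \<rho>) * (l - 1)\<^sup>2)"
        proof (intro mult_left_mono)
          \<comment> \<open>5l - 1 collects 4l from the growth bound and l - 1 from the linear term.
            Since l - 1 > 1, it may be bounded by a multiple of the square; this is the origin of
            the 11.\<close>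
          have "5 * l - 1 \<le> 11 * (l - 1)" using False by simp
          also have "\<dots> \<le> (11 - \<rho>) * (l - 1)\<^sup>2"
            using False \<rho> unfolding power2_eq_square by (intro mult_mono) (auto simp: mult_le_cancel_right1)
          also have "\<dots> \<le> \<epsilon> * (l - 1) + (11 - \<rho>) * (l - 1)\<^sup>2" using False \<epsilon> by simp
          finally show "5 * l - 1 \<le> \<epsilon> * (l - 1) + (11 - \<rho>) * (l - 1)\<^sup>2" .
        qed simp
        finally show ?thesis .
      qed
    qed
  qed
qed

text \<open>Regular variation makes b(y)/b(t) tend to 1 in relative error, even where
  \<open>b\<close> vanishes. It moves the limit lambda from ln(n/k) to any admissible threshold
  sequence.\<close>

lemma b_asymp_equiv:
  fixes y t c :: "nat \<Rightarrow> real"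
  assumes t: "filterlim t at_top sequentially" and yt: "(\<lambda>n. y n / t n) \<longlonglongrightarrow> 1"
    and c: "(\<lambda>n. c n * b (t n)) \<longlonglongrightarrow> a"
  shows "(\<lambda>n. c n * b (y n)) \<longlonglongrightarrow> a"
proof -
  have y: "filterlim y at_top sequentially"
  proof -
    have "filterlim (\<lambda>n. y n / t n * t n) at_top sequentially"
      by (rule filterlim_tendsto_pos_mult_at_top[OF yt _ t]) simp
    moreover have "\<forall>\<^sub>F n in sequentially. t n > 0" using t by (rule filterlim_at_top_dense[THEN iffD1, rule_format])
    then have "\<forall>\<^sub>F n in sequentially. y n / t n * t n = y n" by eventually_elim simp
    ultimately show ?thesis by (subst (asm) filterlim_cong[OF refl refl])
  qed
  have ty: "(\<lambda>n. t n / y n) \<longlonglongrightarrow> 1" using tendsto_inverse[OF yt] by simp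
  have rel: "\<forall>\<^sub>F n in sequentially. \<bar>b (y n) - b (t n)\<bar> \<le> \<epsilon> * \<bar>b (t n)\<bar>" if \<epsilon>: "0 < \<epsilon>" for \<epsilon>
  proof -
    \<comment> \<open>The comparison starts from the smaller of the two points. If that is
      \<open>y n\<close>, the error is in units of b(y); 1/2 yields |b(y)| <= 2 |b(t)|, and
      \<epsilon>/2 pays for the 2.\<close>
    define \<epsilon>' where "\<epsilon>' = min (1/2) (\<epsilon> / 2)"
    have \<epsilon>': "0 < \<epsilon>'" "\<epsilon>' \<le> 1/2" "2 * \<epsilon>' \<le> \<epsilon>" using \<epsilon> by (auto simp: \<epsilon>'_def)
    obtain \<delta> where \<delta>: "0 < \<delta>" and ev: "\<forall>\<^sub>F x in at_top. \<forall>l\<in>{1..1+\<delta>}. \<bar>b (l * x) - b x\<bar> \<le> \<epsilon>' * \<bar>b x\<bar>"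
      using b_ratio_near_1[OF \<epsilon>'(1)] .
    have "\<forall>\<^sub>F n in sequentially. t n > 0" "\<forall>\<^sub>F n in sequentially. y n > 0"
      using t y by (auto intro: filterlim_at_top_dense[THEN iffD1, rule_format])
    moreover have "\<forall>\<^sub>F n in sequentially. y n / t n < 1 + \<delta>" "\<forall>\<^sub>F n in sequentially. t n / y n < 1 + \<delta>"
      using order_tendstoD(2)[OF yt] order_tendstoD(2)[OF ty] \<delta> by auto
    ultimately show ?thesis
      using eventually_compose_filterlim[OF ev t] eventually_compose_filterlim[OF ev y]
    proof eventually_elim
      case (elim n)
      show ?case
      proof (cases "t n \<le> y n")
        case True
        then have "\<bar>b (y n / t n * t n) - b (t n)\<bar> \<le> \<epsilon>' * \<bar>b (t n)\<bar>"
          using elim by (intro elim(5)[rule_format]) auto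
        moreover have "\<epsilon>' * \<bar>b (t n)\<bar> \<le> \<epsilon> * \<bar>b (t n)\<bar>" using \<epsilon>' by (intro mult_right_mono) auto
        ultimately show ?thesis using elim(1) by simp
      next
        case False
        then have *: "\<bar>b (t n / y n * y n) - b (y n)\<bar> \<le> \<epsilon>' * \<bar>b (y n)\<bar>"
          using elim by (intro elim(6)[rule_format]) auto
        have "\<epsilon>' * \<bar>b (y n)\<bar> \<le> 1/2 * \<bar>b (y n)\<bar>" using \<epsilon>' by (intro mult_right_mono) auto
        then have "\<bar>b (y n)\<bar> \<le> 2 * \<bar>b (t n)\<bar>" using * elim(2) by simp
        then have "\<epsilon>' * \<bar>b (y n)\<bar> \<le> \<epsilon>' * (2 * \<bar>b (t n)\<bar>)" using \<epsilon>' by (intro mult_left_mono) auto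
        also have "\<dots> \<le> \<epsilon> * \<bar>b (t n)\<bar>" using \<epsilon>' mult_right_mono[of "2 * \<epsilon>'" \<epsilon> "\<bar>b (t n)\<bar>"] by simp
        finally show ?thesis using * elim(2) by (simp add: abs_minus_commute)
      qed
    qed
  qed
  have "(\<lambda>n. c n * b (y n) - c n * b (t n)) \<longlonglongrightarrow> 0"
  proof (rule tendstoI)
    fix e :: real assume e: "0 < e"
    define \<epsilon> where "\<epsilon> = e / (\<bar>a\<bar> + 1)"
    have \<epsilon>: "0 < \<epsilon>" using e by (simp add: \<epsilon>_def)
    have "\<forall>\<^sub>F n in sequentially. \<bar>c n * b (t n)\<bar> < \<bar>a\<bar> + 1"
      using tendsto_rabs[OF c] by (rule order_tendstoD) simp
    then show "\<forall>\<^sub>F n in sequentially. dist (c n * b (y n) - c n * b (t n)) 0 < e"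
      using rel[OF \<epsilon>]
    proof eventually_elim
      case (elim n)
      have "\<bar>c n * b (y n) - c n * b (t n)\<bar> = \<bar>c n\<bar> * \<bar>b (y n) - b (t n)\<bar>"
        by (simp add: abs_mult[symmetric] algebra_simps)
      also have "\<dots> \<le> \<bar>c n\<bar> * (\<epsilon> * \<bar>b (t n)\<bar>)" using elim by (intro mult_left_mono) auto
      also have "\<dots> = \<epsilon> * \<bar>c n * b (t n)\<bar>" by (simp add: abs_mult)
      also have "\<dots> < \<epsilon> * (\<bar>a\<bar> + 1)" using elim \<epsilon> by (intro mult_strict_left_mono) auto
      also have "\<dots> = e" by (simp add: \<epsilon>_def add_nonneg_eq_0_iff)
      finally show ?case by (simp add: dist_real_def)
    qed
  qed
  from tendsto_add[OF this c] show ?thesis by simp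
qed

end

section \<open>The limit conditionally on the threshold\<close>

lemma exp_law_moment_integrable [simp]: "integrable exp_law (\<lambda>z. z ^ i)"
  using exp_law.erlang_ith_moment_integrable[OF _ exp_law_distributed] by simp

lemma exp_law_moment: "(LINT z|exp_law. z ^ i) = fact i"
  using exp_law.erlang_ith_moment[OF _ exp_law_distributed, of i] by simp

lemma exp_law_id_integrable [simp]: "integrable exp_law (\<lambda>z. z)"
  and exp_law_mean: "(LINT z|exp_law. z) = 1"
  and exp_law_moment2: "(LINT z|exp_law. z\<^sup>2) = 2"
  using exp_law_moment_integrable[of 1] exp_law_moment[of 1] exp_law_moment[of 2] by (simp_all add: fact_numeral)

lemma integral_exp_law_quadratic:
  "(LINT z|exp_law. c * (e * z + d * z\<^sup>2)) = c * (e + d * 2)"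
proof -
  have "(LINT z|exp_law. e * z + d * z\<^sup>2) = (LINT z|exp_law. e * z) + (LINT z|exp_law. d * z\<^sup>2)"
    by (rule Bochner_Integration.integral_add) simp_all
  also have "\<dots> = e + d * 2"
    by (simp only: integral_mult_right_zero exp_law_mean exp_law_moment2 mult_1_right)
  finally show ?thesis by (simp only: integral_mult_right_zero)
qed

lemma mu0_eq_integral: "mu0 t = (LINT z|exp_law. ln (1 + z / t))"
  unfolding mu0_def set_lebesgue_integral_def
  by (subst integral_exp_law) (auto simp: exponential_density_def intro!: Bochner_Integration.integral_cong split: split_indicator)

lemma ln_one_plus_bounds:
  fixes x :: real
  assumes "0 \<le> x"
  shows "0 \<le> ln (1 + x)" "ln (1 + x) \<le> x" "x / (1 + x) \<le> ln (1 + x)"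
proof -
  show "0 \<le> ln (1 + x)" "ln (1 + x) \<le> x" using assms ln_add_one_self_le_self[of x] by auto
  have "ln (1 / (1 + x)) \<le> 1 / (1 + x) - 1" using assms by (intro ln_le_minus_one) auto
  also have "1 / (1 + x) - 1 = - (x / (1 + x))" using assms by (simp add: field_simps)
  finally show "x / (1 + x) \<le> ln (1 + x)" using assms by (simp add: ln_div)
qed

lemma integrable_ln_one_plus:
  assumes "0 < t"
  shows "integrable exp_law (\<lambda>z. ln (1 + z / t))"
proof (rule Bochner_Integration.integrable_bound[where f = "\<lambda>z. z / t"])
  show "AE z in exp_law. norm (ln (1 + z / t)) \<le> norm (z / t)"
    using AE_exp_law_pos
  proof eventually_elim
    case (elim z)
    then have "0 \<le> z / t" using assms by simp
    with ln_one_plus_bounds[OF this] show ?case unfolding real_norm_def by linarith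
  qed
  show "integrable exp_law (\<lambda>z. z / t)" by (rule integrable_divide_zero) simp
  show "(\<lambda>z. ln (1 + z / t)) \<in> borel_measurable exp_law" by measurable
qed

lemma ln_one_plus_diff_le:
  fixes y t z :: real
  assumes "0 < y" "0 < t" "0 \<le> z"
  shows "\<bar>ln (1 + z / y) - ln (1 + z / t)\<bar> \<le> z * (\<bar>y - t\<bar> / (y * t))"
proof -
  have *: "\<bar>ln (1 + z / y) - ln (1 + z / t)\<bar> \<le> z * (\<bar>y - t\<bar> / (y * t))"
    if "0 < y" "y \<le> t" for y t
  proof -
    have zt: "0 \<le> z / t" "z / t \<le> z / y" using that assms by (auto intro: divide_left_mono)
    have "ln (1 + z / y) - ln (1 + z / t) = ln ((1 + z / y) / (1 + z / t))"
      using zt by (subst ln_div) auto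
    also have "\<dots> \<le> (1 + z / y) / (1 + z / t) - 1" using zt by (intro ln_le_minus_one divide_pos_pos) auto
    also have "\<dots> = (z / y - z / t) / (1 + z / t)" 
    proof -
      have "(1 + p) / (1 + r) - 1 = (p - r) / (1 + r)" if "0 \<le> r" for p r :: real
        using that by (simp add: field_simps)
      then show ?thesis using zt(1) by blast
    qed
    also have "\<dots> \<le> (z / y - z / t) / 1" using zt by (intro divide_left_mono) auto
    also have "\<dots> = z * (\<bar>y - t\<bar> / (y * t))" using that by (simp add: field_simps)
    finally have "ln (1 + z / y) - ln (1 + z / t) \<le> z * (\<bar>y - t\<bar> / (y * t))" .
    moreover have "ln (1 + z / t) \<le> ln (1 + z / y)" using zt by (subst ln_le_cancel_iff) auto
    ultimately show ?thesis by simp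
  qed
  show ?thesis
    using *[of y t] *[of t y] assms by (cases "y \<le> t") (simp_all add: abs_minus_commute mult.commute)
qed

lemma integral_abs_bound_AE:
  fixes f g :: "'a \<Rightarrow> real"
  assumes "integrable M f" "integrable M g" "AE x in M. \<bar>f x\<bar> \<le> g x"
  shows "\<bar>integral\<^sup>L M f\<bar> \<le> integral\<^sup>L M g"
proof -
  have "\<bar>integral\<^sup>L M f\<bar> \<le> (LINT x|M. \<bar>f x\<bar>)" using integral_norm_bound[of M f] by simp
  also have "\<dots> \<le> integral\<^sup>L M g" using assms by (intro integral_mono_AE) auto
  finally show ?thesis .
qed

text \<open>The product \<open>y * t\<close> in the denominator is decisive: dividing by T_n ~ 1/t
  leaves |y - t| / t in order of magnitude, negligible against k^(-1/2).\<close>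

lemma mu0_diff_le:
  assumes "0 < y" "0 < t"
  shows "\<bar>mu0 y - mu0 t\<bar> \<le> \<bar>y - t\<bar> / (y * t)"
proof -
  have "mu0 y - mu0 t = (LINT z|exp_law. ln (1 + z / y) - ln (1 + z / t))"
    unfolding mu0_eq_integral using assms by (intro Bochner_Integration.integral_diff[symmetric] integrable_ln_one_plus)
  also have "\<bar>\<dots>\<bar> \<le> (LINT z|exp_law. z * (\<bar>y - t\<bar> / (y * t)))"
  proof (rule integral_abs_bound_AE)
    show "AE z in exp_law. \<bar>ln (1 + z / y) - ln (1 + z / t)\<bar> \<le> z * (\<bar>y - t\<bar> / (y * t))"
      using AE_exp_law_pos by eventually_elim (use assms ln_one_plus_diff_le in auto)
  qed (use assms in \<open>auto intro!: integrable_ln_one_plus\<close>)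
  also have "\<dots> = \<bar>y - t\<bar> / (y * t)" by (simp add: exp_law_mean)
  finally show ?thesis .
qed

text \<open>Dominated convergence after dropping finitely many indices; the bounds derived from
  limits at infinity hold only from some \<open>n\<close> on.\<close>

lemma integral_dominated_convergence_eventually:
  fixes f :: "'a \<Rightarrow> 'b::{banach, second_countable_topology}" and w :: "'a \<Rightarrow> real"
  assumes "f \<in> borel_measurable M" "\<And>i. s i \<in> borel_measurable M" "integrable M w"
    and lim: "AE x in M. (\<lambda>i. s i x) \<longlonglongrightarrow> f x"
    and bound: "\<forall>\<^sub>F i in sequentially. AE x in M. norm (s i x) \<le> w x"
  shows "(\<lambda>i. integral\<^sup>L M (s i)) \<longlonglongrightarrow> integral\<^sup>L M f"
proof -
  obtain N where N: "\<And>i. i \<ge> N \<Longrightarrow> AE x in M. norm (s i x) \<le> w x"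
    using bound unfolding eventually_sequentially by blast
  have "(\<lambda>i. integral\<^sup>L M (s (i + N))) \<longlonglongrightarrow> integral\<^sup>L M f"
  proof (rule integral_dominated_convergence[where w = w])
    show "AE x in M. (\<lambda>i. s (i + N) x) \<longlonglongrightarrow> f x"
      using lim by eventually_elim (rule LIMSEQ_ignore_initial_segment)
  qed (use assms N in auto)
  then show ?thesis by (rule LIMSEQ_offset)
qed

text \<open>The complex power is compared with the real power of 1 + c/k. Both bases lie in the
  closed unit disc, so the powers differ by at most k times the difference of the bases; no complex
  logarithm appears.\<close>

lemma power_tendsto_exp:
  fixes \<psi> :: "nat \<Rightarrow> complex" and k :: "nat \<Rightarrow> nat" and c :: real
  assumes k: "filterlim k at_top sequentially"
    and \<psi>1: "\<And>n. norm (\<psi> n) \<le> 1"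
    and \<psi>: "(\<lambda>n. of_nat (k n) * (\<psi> n - 1)) \<longlonglongrightarrow> of_real c" and c: "c \<le> 0"
  shows "(\<lambda>n. \<psi> n ^ (k n - 1)) \<longlonglongrightarrow> of_real (exp c)"
proof -
  have kr: "filterlim (\<lambda>n. real (k n)) at_top sequentially"
    by (rule filterlim_compose[OF filterlim_real_sequentially k])
  define w where "w n = 1 + c / real (k n)" for n
  have w1: "w \<longlonglongrightarrow> 1"
    unfolding w_def using tendsto_add[OF tendsto_const tendsto_divide_0[OF tendsto_const filterlim_at_top_imp_at_infinity[OF kr]], of 1 c] by simp
  have big: "\<forall>\<^sub>F n in sequentially. real (k n) \<ge> max 1 (- c)"
    using kr by (rule filterlim_at_top[THEN iffD1, rule_format])
  have "(\<lambda>n. w n ^ k n) \<longlonglongrightarrow> exp c"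
    unfolding w_def by (rule filterlim_compose[OF tendsto_exp_limit_sequentially k])
  then have "(\<lambda>n. w n ^ k n / w n) \<longlonglongrightarrow> exp c / 1" using w1 by (intro tendsto_divide) auto
  moreover have "\<forall>\<^sub>F n in sequentially. w n > 0" using w1 by (rule order_tendstoD) simp
  then have "\<forall>\<^sub>F n in sequentially. w n ^ k n / w n = w n ^ (k n - 1)"
    using big by eventually_elim (auto simp: power_diff)
  ultimately have "(\<lambda>n. w n ^ (k n - 1)) \<longlonglongrightarrow> exp c" by (auto dest: Lim_transform_eventually)
  then have wlim: "(\<lambda>n. complex_of_real (w n) ^ (k n - 1)) \<longlonglongrightarrow> of_real (exp c)"
    by (auto dest: tendsto_of_real[where 'a = complex])
  have z: "(\<lambda>n. norm (of_nat (k n) * (\<psi> n - 1) - of_real c)) \<longlonglongrightarrow> 0"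
    using \<psi> by (simp add: LIM_zero tendsto_norm_zero)
  have "(\<lambda>n. \<psi> n ^ (k n - 1) - complex_of_real (w n) ^ (k n - 1)) \<longlonglongrightarrow> 0"
  proof (rule Lim_null_comparison[OF _ z])
    show "\<forall>\<^sub>F n in sequentially. norm (\<psi> n ^ (k n - 1) - complex_of_real (w n) ^ (k n - 1))
      \<le> norm (of_nat (k n) * (\<psi> n - 1) - of_real c)"
      using big
    proof eventually_elim
      case (elim n)
      \<comment> \<open>From \<open>c \<le> 0\<close> and \<open>k n \<ge> - c\<close>, the base
        lies between 0 and 1.\<close>
      have "\<bar>w n\<bar> \<le> 1" using elim c unfolding w_def by (auto simp: field_simps abs_if)
      then have "norm (\<psi> n ^ (k n - 1) - complex_of_real (w n) ^ (k n - 1)) \<le> real (k n - 1) * norm (\<psi> n - of_real (w n))"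
        using \<psi>1 by (intro norm_power_diff) (auto simp: norm_of_real)
      also have "\<dots> \<le> real (k n) * norm (\<psi> n - of_real (w n))" by (intro mult_right_mono) auto
      also have "\<dots> = norm (of_nat (k n) * (\<psi> n - of_real (w n)))" by (simp add: norm_mult)
      also have "of_nat (k n) * (\<psi> n - of_real (w n)) = of_nat (k n) * (\<psi> n - 1) - of_real c"
        using elim by (simp add: w_def field_simps)
      finally show ?case .
    qed
  qed
  from tendsto_add[OF this wlim] show ?thesis by simp
qed

section \<open>The triangular array along a deterministic threshold sequence\<close>

text \<open>\<open>t\<close> stands for ln(n/k) and \<open>y\<close> for a frozen value of the
  threshold. The constant \<open>C\<close> belongs to the sequence; uniformity over thresholds is
  recovered afterwards.\<close>

locale hill_sequence =
  fixes q L b :: "real \<Rightarrow> real" and \<theta> \<rho> lam C :: real and k :: "nat \<Rightarrow> nat" and T t y :: "nat \<Rightarrow> real"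
  assumes \<rho>: "\<rho> \<le> 0" and \<theta>: "\<theta> > 0"
    and q_meas [measurable]: "q \<in> borel_measurable borel"
    and L_pos: "\<forall>\<^sub>F x in at_top. L x > 0"
    and qL: "\<forall>\<^sub>F x in at_top. q x = x powr \<theta> * L x"
    and b0: "(b \<longlongrightarrow> 0) at_top"
    and A2: "\<And>\<Lambda> \<epsilon>. \<Lambda> \<ge> 1 \<Longrightarrow> \<epsilon> > 0 \<Longrightarrow>
       \<forall>\<^sub>F x in at_top. \<forall>u\<in>{1..\<Lambda>}.
          \<bar>ln (L (u * x) / L x) - b x * K_rho \<rho> u\<bar> \<le> \<epsilon> * \<bar>b x * K_rho \<rho> u\<bar>"
    and k: "filterlim k at_top sequentially"
    and t: "filterlim t at_top sequentially"
    and Tpos: "\<And>n. T n > 0"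
    and T_lim: "(\<lambda>n. T n * t n) \<longlonglongrightarrow> 1"
    and lam: "(\<lambda>n. sqrt (real (k n)) * b (t n)) \<longlonglongrightarrow> lam"
    and yC: "\<forall>\<^sub>F n in sequentially. sqrt (real (k n)) * \<bar>y n - t n\<bar> \<le> C"
begin

lemma k_real: "filterlim (\<lambda>n. real (k n)) at_top sequentially"
  by (rule filterlim_compose[OF filterlim_real_sequentially k])

lemma sqrt_k: "filterlim (\<lambda>n. sqrt (real (k n))) at_top sequentially"
  by (rule filterlim_compose[OF sqrt_at_top k_real])

lemma yt_diff: "(\<lambda>n. y n - t n) \<longlonglongrightarrow> 0"
proof (rule Lim_null_comparison)
  show "(\<lambda>n. C / sqrt (real (k n))) \<longlonglongrightarrow> 0"
    by (intro tendsto_divide_0[OF tendsto_const] filterlim_at_top_imp_at_infinity sqrt_k)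
  have "\<forall>\<^sub>F n in sequentially. sqrt (real (k n)) > 0"
    using sqrt_k by (rule filterlim_at_top_dense[THEN iffD1, rule_format])
  with yC show "\<forall>\<^sub>F n in sequentially. norm (y n - t n) \<le> C / sqrt (real (k n))"
    by eventually_elim (simp add: field_simps)
qed

lemma y_at_top: "filterlim y at_top sequentially"
  using filterlim_tendsto_add_at_top[OF yt_diff t] by simp

lemma inverse_t: "(\<lambda>n. 1 / t n) \<longlonglongrightarrow> 0" and inverse_y: "(\<lambda>n. 1 / y n) \<longlonglongrightarrow> 0"
  by (intro tendsto_divide_0[OF tendsto_const] filterlim_at_top_imp_at_infinity t y_at_top)+

lemma y_over_t: "(\<lambda>n. y n / t n) \<longlonglongrightarrow> 1"
proof -
  have "(\<lambda>n. 1 + (y n - t n) * (1 / t n)) \<longlonglongrightarrow> 1 + 0 * 0"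
    by (intro tendsto_intros yt_diff inverse_t)
  moreover have "\<forall>\<^sub>F n in sequentially. t n > 0" using t by (rule filterlim_at_top_dense[THEN iffD1, rule_format])
  then have "\<forall>\<^sub>F n in sequentially. 1 + (y n - t n) * (1 / t n) = y n / t n"
    by eventually_elim (simp add: field_simps)
  ultimately show ?thesis by (auto dest: Lim_transform_eventually)
qed

lemma Ty: "(\<lambda>n. T n * y n) \<longlonglongrightarrow> 1"
proof -
  have "(\<lambda>n. (T n * t n) * (y n / t n)) \<longlonglongrightarrow> 1 * 1" by (intro tendsto_intros T_lim y_over_t)
  moreover have "\<forall>\<^sub>F n in sequentially. t n > 0" using t by (rule filterlim_at_top_dense[THEN iffD1, rule_format])
  then have "\<forall>\<^sub>F n in sequentially. (T n * t n) * (y n / t n) = T n * y n" by eventually_elim simp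
  ultimately show ?thesis by (auto dest: Lim_transform_eventually)
qed

lemma T_0: "T \<longlonglongrightarrow> 0"
proof -
  have "(\<lambda>n. (T n * t n) * (1 / t n)) \<longlonglongrightarrow> 1 * 0" by (intro tendsto_intros T_lim inverse_t)
  moreover have "\<forall>\<^sub>F n in sequentially. t n > 0" using t by (rule filterlim_at_top_dense[THEN iffD1, rule_format])
  then have "\<forall>\<^sub>F n in sequentially. (T n * t n) * (1 / t n) = T n" by eventually_elim simp
  ultimately show ?thesis by (auto dest: Lim_transform_eventually)
qed

lemma sqrt_k_b_y: "(\<lambda>n. sqrt (real (k n)) * b (y n)) \<longlonglongrightarrow> lam"
  by (rule b_asymp_equiv[OF \<rho> L_pos _ t y_over_t lam]) (rule A2; assumption)

lemma b_y: "(\<lambda>n. b (y n)) \<longlonglongrightarrow> 0"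
  by (rule filterlim_compose[OF b0 y_at_top])

abbreviation R :: "nat \<Rightarrow> real \<Rightarrow> real" where
  "R n z \<equiv> ln (q (y n + z)) - ln (q (y n))"

text \<open>With q(x) = x^theta L(x) and factor l = 1 + z/y, the log-spacing splits into theta ln l
  and a log-ratio of \<open>L\<close>, to which the second-order bound applies for all z >= 0 at
  once.\<close>

lemma R_expansion:
  assumes \<epsilon>: "0 < \<epsilon>"
  shows "\<forall>\<^sub>F n in sequentially. y n \<ge> 1 \<and> (\<forall>z\<ge>0. \<bar>R n z - \<theta> * ln (1 + z / y n) - b (y n) * (z / y n)\<bar>
    \<le> \<bar>b (y n)\<bar> * (\<epsilon> * (z / y n) + (11 - \<rho>) * (z / y n)\<^sup>2))"
proof -
  have ev: "\<forall>\<^sub>F x in at_top. L x > 0 \<and> q x = x powr \<theta> * L x"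
    using L_pos qL by eventually_elim simp
  have expansion: "\<forall>\<^sub>F x in at_top. \<forall>l\<ge>1. \<bar>ln (L (l * x) / L x) - b x * (l - 1)\<bar>
      \<le> \<bar>b x\<bar> * (\<epsilon> * (l - 1) + (11 - \<rho>) * (l - 1)\<^sup>2)"
    by (rule ln_L_ratio_expansion[OF \<rho> L_pos _ \<epsilon>]) (rule A2; assumption)
  from ev obtain x1 where x1: "\<And>x. x \<ge> x1 \<Longrightarrow> L x > 0" "\<And>x. x \<ge> x1 \<Longrightarrow> q x = x powr \<theta> * L x"
    unfolding eventually_at_top_linorder by blast
  have "\<forall>\<^sub>F n in sequentially. y n \<ge> max 1 x1"
    using y_at_top by (rule filterlim_at_top[THEN iffD1, rule_format])
  then show ?thesis
    using eventually_compose_filterlim[OF expansion y_at_top]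
  proof eventually_elim
    case (elim n)
    have "\<bar>R n z - \<theta> * ln (1 + z / y n) - b (y n) * (z / y n)\<bar> \<le> \<bar>b (y n)\<bar> * (\<epsilon> * (z / y n) + (11 - \<rho>) * (z / y n)\<^sup>2)"
      if z: "0 \<le> z" for z
    proof -
      let ?l = "1 + z / y n"
      have y: "y n > 0" using elim by simp
      have l: "?l \<ge> 1" using y z by simp
      have ly: "?l * y n = y n + z" using y by (simp add: field_simps)
      have pos: "L (y n) > 0" "L (y n + z) > 0" using x1(1) elim z by auto
      have "ln (q (y n + z)) = \<theta> * ln (y n + z) + ln (L (y n + z))"
        using x1(2)[of "y n + z"] elim z y pos by (simp add: ln_mult ln_powr)
      moreover have "ln (q (y n)) = \<theta> * ln (y n) + ln (L (y n))"
        using x1(2)[of "y n"] elim y pos by (simp add: ln_mult ln_powr)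
      moreover have "ln (y n + z) = ln ?l + ln (y n)" unfolding ly[symmetric] using l y by (intro ln_mult_pos) auto
      ultimately have "R n z = \<theta> * ln ?l + ln (L (?l * y n) / L (y n))"
        unfolding ly using pos by (simp add: ln_div algebra_simps)
      then show ?thesis using elim(2)[rule_format, OF l] by simp
    qed
    then show ?case using elim by auto
  qed
qed

text \<open>Contribution of one exceedance to the estimator: the log-spacing is of order 1/y, and
  dividing by T_n brings it to order 1.\<close>

definition W where "W n z = R n z / T n"

lemma W_meas [measurable]: "W n \<in> borel_measurable borel"
  unfolding W_def by measurable

text \<open>A polynomial majorant free of \<open>n\<close>; it has all exponential moments and so
  serves every dominated convergence below.\<close>

lemma W_bound: "\<forall>\<^sub>F n in sequentially. \<forall>z\<ge>0. \<bar>W n z\<bar> \<le> (2 * \<theta> + 26 - 2 * \<rho>) * (z + z\<^sup>2)"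
proof -
  have "\<forall>\<^sub>F n in sequentially. T n * y n > 1/2" using Ty by (rule order_tendstoD) simp
  moreover have "\<forall>\<^sub>F n in sequentially. \<bar>b (y n)\<bar> < 1" using tendsto_rabs[OF b_y] by (rule order_tendstoD) simp
  ultimately show ?thesis using R_expansion[OF zero_less_one]
  proof eventually_elim
    case (elim n)
    show ?case
    proof (intro allI impI)
      fix z :: real assume z: "0 \<le> z"
      define v where "v = z / y n"
      have y: "y n \<ge> 1" using elim by simp
      have v: "0 \<le> v" "v / T n \<le> 2 * z" "v \<le> z"
      proof -
        show "0 \<le> v" using z y by (simp add: v_def)
        have "v / T n = z / (T n * y n)" by (simp add: v_def mult.commute)
        also have "\<dots> \<le> z / (1/2)" using elim z by (intro divide_left_mono) auto
        finally show "v / T n \<le> 2 * z" by simp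
        show "v \<le> z" unfolding v_def using y z by (simp add: divide_le_eq mult_le_cancel_left1)
      qed
      have "\<bar>R n z - \<theta> * ln (1 + v) - b (y n) * v\<bar> \<le> \<bar>b (y n)\<bar> * (1 * v + (11 - \<rho>) * v\<^sup>2)"
        using elim z by (simp add: v_def)
      also have "\<dots> \<le> 1 * (1 * v + (11 - \<rho>) * v\<^sup>2)"
        using elim v \<rho> by (intro mult_right_mono) auto
      finally have "\<bar>R n z - \<theta> * ln (1 + v) - b (y n) * v\<bar> \<le> v + (11 - \<rho>) * v\<^sup>2" by simp
      moreover have "\<bar>b (y n) * v\<bar> \<le> v" using elim v by (simp add: abs_mult mult_left_le_one_le)
      moreover have "0 \<le> \<theta> * ln (1 + v)" "\<theta> * ln (1 + v) \<le> \<theta> * v"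
        using ln_one_plus_bounds[OF v(1)] \<theta> by auto
      \<comment> \<open>Only one factor v is kept for the division by T_n, where v / T_n <= 2z; the
        other is bounded by z.\<close>
      moreover have "(11 - \<rho>) * v\<^sup>2 \<le> (11 - \<rho>) * (v * z)"
        using v \<rho> by (intro mult_left_mono) (auto simp: power2_eq_square intro: mult_left_mono)
      ultimately have "\<bar>R n z\<bar> \<le> \<theta> * v + 2 * v + (11 - \<rho>) * (v * z)" by linarith
      also have "\<dots> = v * (\<theta> + 2 + (11 - \<rho>) * z)" by (simp add: algebra_simps)
      finally have "\<bar>W n z\<bar> \<le> v * (\<theta> + 2 + (11 - \<rho>) * z) / T n"
        unfolding W_def using Tpos[of n] by (simp add: abs_divide divide_right_mono)
      also have "\<dots> = v / T n * (\<theta> + 2 + (11 - \<rho>) * z)" by simp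
      also have "\<dots> \<le> 2 * z * (\<theta> + 2 + (11 - \<rho>) * z)"
        using v z \<theta> \<rho> by (intro mult_right_mono) auto
      also have "\<dots> = (2 * \<theta> + 4) * z + (22 - 2 * \<rho>) * z\<^sup>2" by (simp add: algebra_simps power2_eq_square)
      \<comment> \<open>The sum of both coefficients serves as a common constant.\<close>
      also have "\<dots> \<le> (2 * \<theta> + 26 - 2 * \<rho>) * z + (2 * \<theta> + 26 - 2 * \<rho>) * z\<^sup>2"
        using z \<theta> \<rho> by (intro add_mono mult_right_mono) auto
      finally show "\<bar>W n z\<bar> \<le> (2 * \<theta> + 26 - 2 * \<rho>) * (z + z\<^sup>2)" by (simp add: distrib_left)
    qed
  qed
qed

text \<open>x/(1+x) <= ln(1+x) <= x squeezes the leading term, because T_n y_n tends to 1 and T_n to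
  0; the remaining terms carry b(y), which vanishes.\<close>

lemma W_lim:
  assumes z: "0 \<le> z"
  shows "(\<lambda>n. W n z) \<longlonglongrightarrow> \<theta> * z"
proof -
  have vT: "(\<lambda>n. z / (T n * y n)) \<longlonglongrightarrow> z / 1" by (intro tendsto_divide tendsto_const Ty) simp
  have "(\<lambda>n. z / (T n * y n + T n * z)) \<longlonglongrightarrow> z / (1 + 0 * z)"
    by (intro tendsto_intros Ty T_0) simp
  then have lo: "(\<lambda>n. z / (T n * y n + T n * z)) \<longlonglongrightarrow> z" by simp
  have y1: "\<forall>\<^sub>F n in sequentially. y n \<ge> 1" using y_at_top by (rule filterlim_at_top[THEN iffD1, rule_format])
  have ln: "(\<lambda>n. ln (1 + z / y n) / T n) \<longlonglongrightarrow> z"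
  proof (rule tendsto_sandwich[OF _ _ lo])
    show "(\<lambda>n. z / (T n * y n)) \<longlonglongrightarrow> z" using vT by simp
    show "\<forall>\<^sub>F n in sequentially. ln (1 + z / y n) / T n \<le> z / (T n * y n)"
      using y1
    proof eventually_elim
      case (elim n)
      then have "ln (1 + z / y n) / T n \<le> (z / y n) / T n"
        using ln_one_plus_bounds[of "z / y n"] z Tpos[of n] by (intro divide_right_mono) auto
      then show ?case by (simp add: mult.commute)
    qed
    show "\<forall>\<^sub>F n in sequentially. z / (T n * y n + T n * z) \<le> ln (1 + z / y n) / T n"
      using y1
    proof eventually_elim
      case (elim n)
      have "z / (T n * y n + T n * z) = (z / y n) / (1 + z / y n) / T n"
      proof -
        have "(z / y n) / (1 + z / y n) = z / (y n + z)" using elim z by (simp add: field_simps)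
        moreover have "z / (T n * y n + T n * z) = z / (y n + z) / T n"
          unfolding divide_divide_eq_left by (simp add: algebra_simps)
        ultimately show ?thesis by (simp only:)
      qed
      also have "\<dots> \<le> ln (1 + z / y n) / T n"
        using ln_one_plus_bounds[of "z / y n"] z Tpos[of n] elim by (intro divide_right_mono) auto
      finally show ?case .
    qed
  qed
  have "(\<lambda>n. W n z - \<theta> * (ln (1 + z / y n) / T n)) \<longlonglongrightarrow> 0"
  proof (rule Lim_null_comparison)
    have "(\<lambda>n. \<bar>b (y n)\<bar> * (2 * (z / (T n * y n)) + (11 - \<rho>) * (z / (T n * y n)) * (z * (1 / y n)))) \<longlonglongrightarrow>
      \<bar>0\<bar> * (2 * (z / 1) + (11 - \<rho>) * (z / 1) * (z * 0))"
      by (intro tendsto_intros b_y vT inverse_y tendsto_rabs)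
    then show "(\<lambda>n. \<bar>b (y n)\<bar> * (2 * (z / (T n * y n)) + (11 - \<rho>) * (z / (T n * y n)) * (z * (1 / y n)))) \<longlonglongrightarrow> 0" by simp
    show "\<forall>\<^sub>F n in sequentially. norm (W n z - \<theta> * (ln (1 + z / y n) / T n))
      \<le> \<bar>b (y n)\<bar> * (2 * (z / (T n * y n)) + (11 - \<rho>) * (z / (T n * y n)) * (z * (1 / y n)))"
      using R_expansion[OF zero_less_one]
    proof eventually_elim
      case (elim n)
      define v where "v = z / y n"
      have v: "0 \<le> v" using elim z by (simp add: v_def)
      have "\<bar>R n z - \<theta> * ln (1 + v) - b (y n) * v\<bar> \<le> \<bar>b (y n)\<bar> * (1 * v + (11 - \<rho>) * v\<^sup>2)"
        using elim z by (simp add: v_def)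
      moreover have "\<bar>b (y n) * v\<bar> = \<bar>b (y n)\<bar> * v" using v by (simp add: abs_mult)
      ultimately have "\<bar>R n z - \<theta> * ln (1 + v)\<bar> \<le> \<bar>b (y n)\<bar> * v + \<bar>b (y n)\<bar> * (v + (11 - \<rho>) * v\<^sup>2)"
        unfolding mult_1 by linarith
      also have "\<dots> = \<bar>b (y n)\<bar> * (2 * v + (11 - \<rho>) * v\<^sup>2)" by (simp add: algebra_simps)
      finally have "\<bar>R n z - \<theta> * ln (1 + v)\<bar> / T n \<le> \<bar>b (y n)\<bar> * (2 * v + (11 - \<rho>) * v\<^sup>2) / T n"
        using Tpos[of n] by (intro divide_right_mono) auto
      moreover have "norm (W n z - \<theta> * (ln (1 + z / y n) / T n)) = \<bar>R n z - \<theta> * ln (1 + v)\<bar> / T n"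
      proof -
        have "W n z - \<theta> * (ln (1 + z / y n) / T n) = (R n z - \<theta> * ln (1 + v)) / T n"
          by (simp add: W_def v_def diff_divide_distrib)
        then show ?thesis using Tpos[of n] by (simp only: real_norm_def abs_divide abs_of_pos)
      qed
      moreover have "\<bar>b (y n)\<bar> * (2 * v + (11 - \<rho>) * v\<^sup>2) / T n
        = \<bar>b (y n)\<bar> * (2 * (z / (T n * y n)) + (11 - \<rho>) * (z / (T n * y n)) * (z * (1 / y n)))"
        using elim Tpos[of n] by (simp add: v_def power2_eq_square field_simps)
      ultimately show ?case by simp
    qed
  qed
  from tendsto_add[OF this tendsto_mult[OF tendsto_const ln, of \<theta>]] show ?thesis by simp
qed

lemma W_integrable: "\<forall>\<^sub>F n in sequentially. integrable exp_law (W n)"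
  using W_bound
proof eventually_elim
  case (elim n)
  show ?case
  proof (rule Bochner_Integration.integrable_bound)
    show "integrable exp_law (\<lambda>z. (2 * \<theta> + 26 - 2 * \<rho>) * (z + z\<^sup>2))" by simp
    show "AE z in exp_law. norm (W n z) \<le> norm ((2 * \<theta> + 26 - 2 * \<rho>) * (z + z\<^sup>2))"
      using AE_exp_law_pos by eventually_elim (use elim in \<open>auto intro!: order_trans[OF _ abs_ge_self]\<close>)
  qed simp
qed

definition m where "m n = (LINT z|exp_law. W n z)"

lemma m_lim: "m \<longlonglongrightarrow> \<theta>"
proof -
  have "(\<lambda>n. LINT z|exp_law. W n z) \<longlonglongrightarrow> (LINT z|exp_law. \<theta> * z)"
  proof (rule integral_dominated_convergence_eventually)
    show "integrable exp_law (\<lambda>z. (2 * \<theta> + 26 - 2 * \<rho>) * (z + z\<^sup>2))" by simp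
    show "AE z in exp_law. (\<lambda>n. W n z) \<longlonglongrightarrow> \<theta> * z"
      using AE_exp_law_pos by eventually_elim (simp add: W_lim)
    show "\<forall>\<^sub>F n in sequentially. AE z in exp_law. norm (W n z) \<le> (2 * \<theta> + 26 - 2 * \<rho>) * (z + z\<^sup>2)"
      using W_bound
    proof eventually_elim
      case (elim n)
      show ?case using AE_exp_law_pos by eventually_elim (use elim in auto)
    qed
  qed simp_all
  then show ?thesis unfolding m_def by (simp add: exp_law_mean)
qed

text \<open>\<open>R_expansion\<close> integrated with the moments 1 and 2 of the exponential law,
  whence 22 - 2 rho = 2 (11 - rho). Unlike \<open>m_lim\<close>, the error is measured in units of
  b(y).\<close>

lemma mean_expansion:
  assumes \<epsilon>: "0 < \<epsilon>"
  shows "\<forall>\<^sub>F n in sequentially. \<bar>m n - \<theta> * mu0 (y n) / T n - b (y n) / (T n * y n)\<bar>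
    \<le> \<bar>b (y n)\<bar> * (\<epsilon> + (22 - 2 * \<rho>) * (1 / y n)) / (T n * y n)"
  using R_expansion[OF \<epsilon>] W_integrable
proof eventually_elim
  case (elim n)
  have y: "y n > 0" using elim by simp
  have int: "integrable exp_law (\<lambda>z. \<theta> * ln (1 + z / y n) / T n)"
    using integrable_ln_one_plus[OF y] by simp
  have eq: "m n - \<theta> * mu0 (y n) / T n - b (y n) / (T n * y n) =
    (LINT z|exp_law. W n z - \<theta> * ln (1 + z / y n) / T n - b (y n) / (T n * y n) * z)"
    using elim(2) int by (simp add: m_def mu0_eq_integral exp_law_mean)
  have "\<bar>m n - \<theta> * mu0 (y n) / T n - b (y n) / (T n * y n)\<bar> \<le> (LINT z|exp_law. \<bar>b (y n)\<bar> / (T n * y n) * (\<epsilon> * z + (11 - \<rho>) / y n * z\<^sup>2))"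
    unfolding eq
  proof (rule integral_abs_bound_AE)
    show "AE z in exp_law. \<bar>W n z - \<theta> * ln (1 + z / y n) / T n - b (y n) / (T n * y n) * z\<bar>
      \<le> \<bar>b (y n)\<bar> / (T n * y n) * (\<epsilon> * z + (11 - \<rho>) / y n * z\<^sup>2)"
      using AE_exp_law_pos
    proof eventually_elim
      fix z :: real assume z: "0 < z"
      have "\<bar>R n z - \<theta> * ln (1 + z / y n) - b (y n) * (z / y n)\<bar> / T n
          \<le> \<bar>b (y n)\<bar> * (\<epsilon> * (z / y n) + (11 - \<rho>) * (z / y n)\<^sup>2) / T n"
        using elim(1) z Tpos[of n] by (intro divide_right_mono) auto
      moreover have "\<bar>R n z - \<theta> * ln (1 + z / y n) - b (y n) * (z / y n)\<bar> / T n =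
         \<bar>W n z - \<theta> * ln (1 + z / y n) / T n - b (y n) / (T n * y n) * z\<bar>"
      proof -
        have "W n z - \<theta> * ln (1 + z / y n) / T n - b (y n) / (T n * y n) * z =
          (R n z - \<theta> * ln (1 + z / y n) - b (y n) * (z / y n)) / T n"
          by (simp add: W_def diff_divide_distrib mult.commute)
        then show ?thesis using Tpos[of n] by (simp only: abs_divide abs_of_pos)
      qed
      moreover have "\<bar>b (y n)\<bar> * (\<epsilon> * (z / y n) + (11 - \<rho>) * (z / y n)\<^sup>2) / T n
         = \<bar>b (y n)\<bar> / (T n * y n) * (\<epsilon> * z + (11 - \<rho>) / y n * z\<^sup>2)"
        using y Tpos[of n] by (simp add: field_simps power2_eq_square)
      ultimately show "\<bar>W n z - \<theta> * ln (1 + z / y n) / T n - b (y n) / (T n * y n) * z\<bar>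
      \<le> \<bar>b (y n)\<bar> / (T n * y n) * (\<epsilon> * z + (11 - \<rho>) / y n * z\<^sup>2)" by simp
    qed
    show "integrable exp_law (\<lambda>z. W n z - \<theta> * ln (1 + z / y n) / T n - b (y n) / (T n * y n) * z)"
      using elim(2) int by (intro Bochner_Integration.integrable_diff integrable_mult_right) simp_all
    show "integrable exp_law (\<lambda>z. \<bar>b (y n)\<bar> / (T n * y n) * (\<epsilon> * z + (11 - \<rho>) / y n * z\<^sup>2))"
      by (intro integrable_mult_right Bochner_Integration.integrable_add) simp_all
  qed
  also have "\<dots> = \<bar>b (y n)\<bar> * (\<epsilon> + (22 - 2 * \<rho>) * (1 / y n)) / (T n * y n)"
  proof -
    have e: "(11 - \<rho>) / y n * 2 = (22 - 2 * \<rho>) * (1 / y n)"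
      by (simp only: divide_inverse) (simp add: left_diff_distrib)
    show ?thesis unfolding integral_exp_law_quadratic e by (rule times_divide_eq_left)
  qed
  finally show ?case .
qed

text \<open>The conditional mean agrees with the deterministic centring to within o(k^(-1/2)). Three
  errors must vanish: the expansion remainder, the move of \<open>mu0\<close> from \<open>y\<close>
  to \<open>t\<close>, and the replacement of b(y)/(T y) by b(t).\<close>

lemma mean_lim: "(\<lambda>n. sqrt (real (k n)) * (m n - \<theta> * mu0 (t n) / T n - b (t n))) \<longlonglongrightarrow> 0"
proof -
  have iTy: "(\<lambda>n. 1 / (T n * y n)) \<longlonglongrightarrow> 1 / 1" by (intro tendsto_intros Ty) simp
  have 1: "(\<lambda>n. sqrt (real (k n)) * (m n - \<theta> * mu0 (y n) / T n - b (y n) / (T n * y n))) \<longlonglongrightarrow> 0"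
  proof (rule tendstoI)
    fix e :: real assume e: "0 < e"
    \<comment> \<open>Multiplied by sqrt k, the remainder tends to |lam| times this constant, which
      is below \<open>e\<close>.\<close>
    define \<epsilon> where "\<epsilon> = e / (2 * (\<bar>lam\<bar> + 1))"
    have \<epsilon>: "0 < \<epsilon>" unfolding \<epsilon>_def using e by (intro divide_pos_pos) auto
    have "(\<lambda>n. \<bar>sqrt (real (k n)) * b (y n)\<bar> * (\<epsilon> + (22 - 2 * \<rho>) * (1 / y n)) * (1 / (T n * y n)))
       \<longlonglongrightarrow> \<bar>lam\<bar> * (\<epsilon> + (22 - 2 * \<rho>) * 0) * (1 / 1)"
      by (intro tendsto_mult tendsto_add tendsto_const tendsto_rabs sqrt_k_b_y inverse_y iTy)
    moreover have "\<bar>lam\<bar> * (\<epsilon> + (22 - 2 * \<rho>) * 0) * (1 / 1) < e"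
    proof -
      have "\<bar>lam\<bar> * \<epsilon> < 2 * (\<bar>lam\<bar> + 1) * \<epsilon>" using \<epsilon> by (intro mult_strict_right_mono) auto
      also have "\<dots> = e" unfolding \<epsilon>_def using e by (simp add: add_nonneg_eq_0_iff)
      finally show ?thesis by simp
    qed
    ultimately have "\<forall>\<^sub>F n in sequentially. \<bar>sqrt (real (k n)) * b (y n)\<bar> * (\<epsilon> + (22 - 2 * \<rho>) * (1 / y n)) * (1 / (T n * y n)) < e"
      by (rule order_tendstoD)
    then show "\<forall>\<^sub>F n in sequentially. dist (sqrt (real (k n)) * (m n - \<theta> * mu0 (y n) / T n - b (y n) / (T n * y n))) 0 < e"
      using mean_expansion[OF \<epsilon>]
    proof eventually_elim
      case (elim n)
      have "\<bar>sqrt (real (k n)) * (m n - \<theta> * mu0 (y n) / T n - b (y n) / (T n * y n))\<bar>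
        \<le> sqrt (real (k n)) * (\<bar>b (y n)\<bar> * (\<epsilon> + (22 - 2 * \<rho>) * (1 / y n)) / (T n * y n))"
        unfolding abs_mult using elim by (intro mult_mono) auto
      also have "\<dots> = \<bar>sqrt (real (k n)) * b (y n)\<bar> * (\<epsilon> + (22 - 2 * \<rho>) * (1 / y n)) * (1 / (T n * y n))"
        by (simp add: abs_mult)
      finally show ?case using elim by simp
    qed
  qed
  have 2: "(\<lambda>n. sqrt (real (k n)) * (\<theta> * (mu0 (y n) - mu0 (t n)) / T n)) \<longlonglongrightarrow> 0"
  proof (rule Lim_null_comparison)
    have "(\<lambda>n. \<theta> * C * (1 / (T n * y n)) * (1 / t n)) \<longlonglongrightarrow> \<theta> * C * (1 / 1) * 0"
      by (intro tendsto_mult tendsto_const iTy inverse_t)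
    then show "(\<lambda>n. \<theta> * C * (1 / (T n * y n)) * (1 / t n)) \<longlonglongrightarrow> 0" by simp
    have "\<forall>\<^sub>F n in sequentially. t n > 0" "\<forall>\<^sub>F n in sequentially. y n > 0"
      using t y_at_top by (auto intro: filterlim_at_top_dense[THEN iffD1, rule_format])
    then show "\<forall>\<^sub>F n in sequentially. norm (sqrt (real (k n)) * (\<theta> * (mu0 (y n) - mu0 (t n)) / T n)) \<le> \<theta> * C * (1 / (T n * y n)) * (1 / t n)"
      using yC
    proof eventually_elim
      case (elim n)
      have "norm (sqrt (real (k n)) * (\<theta> * (mu0 (y n) - mu0 (t n)) / T n)) = sqrt (real (k n)) * (\<theta> * \<bar>mu0 (y n) - mu0 (t n)\<bar> / T n)"
        using \<theta> Tpos[of n] by (simp add: abs_mult)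
      also have "\<dots> \<le> sqrt (real (k n)) * (\<theta> * (\<bar>y n - t n\<bar> / (y n * t n)) / T n)"
        using mu0_diff_le[of "y n" "t n"] elim \<theta> Tpos[of n] by (intro mult_left_mono divide_right_mono) auto
      also have "\<dots> = (sqrt (real (k n)) * \<bar>y n - t n\<bar>) * (\<theta> * (1 / (T n * y n)) * (1 / t n))"
        by (simp add: mult_ac)
      also have "\<dots> \<le> C * (\<theta> * (1 / (T n * y n)) * (1 / t n))"
        using elim \<theta> Tpos[of n] by (intro mult_right_mono) auto
      finally show ?case by (simp add: mult_ac)
    qed
  qed
  have 3: "(\<lambda>n. sqrt (real (k n)) * b (y n) * (1 / (T n * y n)) - sqrt (real (k n)) * b (t n)) \<longlonglongrightarrow> lam * (1 / 1) - lam"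
    by (intro tendsto_diff tendsto_mult sqrt_k_b_y iTy lam)
  have "(\<lambda>n. sqrt (real (k n)) * (m n - \<theta> * mu0 (y n) / T n - b (y n) / (T n * y n))
      + sqrt (real (k n)) * (\<theta> * (mu0 (y n) - mu0 (t n)) / T n)
      + (sqrt (real (k n)) * b (y n) * (1 / (T n * y n)) - sqrt (real (k n)) * b (t n))) \<longlonglongrightarrow> 0"
    using tendsto_add[OF tendsto_add[OF 1 2] 3] by simp
  moreover have "sqrt (real (k n)) * (m n - \<theta> * mu0 (y n) / T n - b (y n) / (T n * y n))
      + sqrt (real (k n)) * (\<theta> * (mu0 (y n) - mu0 (t n)) / T n)
      + (sqrt (real (k n)) * b (y n) * (1 / (T n * y n)) - sqrt (real (k n)) * b (t n))
    = sqrt (real (k n)) * (m n - \<theta> * mu0 (t n) / T n - b (t n))" for n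
    by (simp add: algebra_simps diff_divide_distrib)
  ultimately show ?thesis by simp
qed

definition psi :: "real \<Rightarrow> nat \<Rightarrow> complex" where
  "psi s n = (LINT z|exp_law. iexp (s * (W n z - m n) / sqrt (real (k n))))"

text \<open>Dominated convergence for the scaled Taylor remainder replaces a Lindeberg condition.
  The limit is minus half of s^2 times the variance of theta Z, and Z has variance 1.\<close>

lemma psi_lim: "(\<lambda>n. of_nat (k n) * (psi s n - 1)) \<longlonglongrightarrow> of_real (- (s\<^sup>2 * \<theta>\<^sup>2 / 2))"
proof -
  define B where "B = 2 * \<theta> + 26 - 2 * \<rho>"
  have B: "B \<ge> 0" using \<theta> \<rho> by (simp add: B_def)
  define a where "a n z = s * (W n z - m n) / sqrt (real (k n))" for n z
  have a_meas [measurable]: "a n \<in> borel_measurable borel" for n unfolding a_def by measurable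
  \<comment> \<open>The linear term is subtracted inside the integral, where centring makes its
    contribution zero.\<close>
  define D where "D n z = of_nat (k n) * (iexp (a n z) - 1 - \<i> * a n z)" for n z
  have D_meas [measurable]: "D n \<in> borel_measurable borel" for n unfolding D_def by measurable
  have k1: "\<forall>\<^sub>F n in sequentially. real (k n) \<ge> 1"
    using k_real by (rule filterlim_at_top[THEN iffD1, rule_format])
  have ka: "real (k n) * (a n z)\<^sup>2 = s\<^sup>2 * (W n z - m n)\<^sup>2" if "real (k n) \<ge> 1" for n z
    using that by (simp add: a_def power_divide power_mult_distrib)
  have "(\<lambda>n. LINT z|exp_law. D n z) \<longlonglongrightarrow> (LINT z|exp_law. complex_of_real (- (s\<^sup>2 * (\<theta> * z - \<theta>)\<^sup>2 / 2)))"
  proof (rule integral_dominated_convergence_eventually)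
    show "integrable exp_law (\<lambda>z. s\<^sup>2 / 2 * (B * (z + z\<^sup>2) + (\<theta> + 1))\<^sup>2)"
    proof -
      have eq: "(B * (z + z\<^sup>2) + (\<theta> + 1))\<^sup>2 = B\<^sup>2 * z ^ 4 + 2 * B\<^sup>2 * z ^ 3 + (B\<^sup>2 + 2 * B * (\<theta> + 1)) * z\<^sup>2 + 2 * B * (\<theta> + 1) * z + (\<theta> + 1)\<^sup>2" for z
        by (simp add: power2_eq_square power3_eq_cube power4_eq_xxxx algebra_simps)
      show ?thesis unfolding eq
        by (intro integrable_mult_right Bochner_Integration.integrable_add exp_law_moment_integrable exp_law_id_integrable) simp
    qed
    show "AE z in exp_law. (\<lambda>n. D n z) \<longlonglongrightarrow> complex_of_real (- (s\<^sup>2 * (\<theta> * z - \<theta>)\<^sup>2 / 2))"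
      using AE_exp_law_pos
    proof eventually_elim
      case (elim z)
      have X: "(\<lambda>n. W n z - m n) \<longlonglongrightarrow> \<theta> * z - \<theta>" using elim by (intro tendsto_diff W_lim m_lim) auto
      have quad: "(\<lambda>n. complex_of_real (- (s\<^sup>2 * (W n z - m n)\<^sup>2 / 2))) \<longlonglongrightarrow> complex_of_real (- (s\<^sup>2 * (\<theta> * z - \<theta>)\<^sup>2 / 2))"
        by (intro tendsto_of_real tendsto_minus tendsto_divide tendsto_mult tendsto_power X tendsto_const) simp
      \<comment> \<open>After multiplication by k the cubic Taylor remainder is still of order
        k^(-1/2).\<close>
      have "(\<lambda>n. D n z - complex_of_real (- (s\<^sup>2 * (W n z - m n)\<^sup>2 / 2))) \<longlonglongrightarrow> 0"
      proof (rule Lim_null_comparison)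
        have "(\<lambda>n. \<bar>s * (W n z - m n)\<bar> ^ 3 * (1 / sqrt (real (k n)))) \<longlonglongrightarrow> \<bar>s * (\<theta> * z - \<theta>)\<bar> ^ 3 * 0"
          by (intro tendsto_mult tendsto_power tendsto_rabs X tendsto_const
              tendsto_divide_0[OF tendsto_const] filterlim_at_top_imp_at_infinity sqrt_k)
        then show "(\<lambda>n. \<bar>s * (W n z - m n)\<bar> ^ 3 * (1 / sqrt (real (k n)))) \<longlonglongrightarrow> 0" by simp
        show "\<forall>\<^sub>F n in sequentially. norm (D n z - complex_of_real (- (s\<^sup>2 * (W n z - m n)\<^sup>2 / 2)))
          \<le> \<bar>s * (W n z - m n)\<bar> ^ 3 * (1 / sqrt (real (k n)))"
          using k1
        proof eventually_elim
          case (elim n)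
          have "D n z - complex_of_real (- (s\<^sup>2 * (W n z - m n)\<^sup>2 / 2))
              = of_nat (k n) * (iexp (a n z) - (\<Sum>j\<le>2. (\<i> * a n z) ^ j / fact j))"
            unfolding ka[OF elim, symmetric] D_def by (simp add: numeral_2_eq_2 power_mult_distrib algebra_simps)
          then have "norm (D n z - complex_of_real (- (s\<^sup>2 * (W n z - m n)\<^sup>2 / 2)))
              = real (k n) * norm (iexp (a n z) - (\<Sum>j\<le>2. (\<i> * a n z) ^ j / fact j))"
            by (simp add: norm_mult)
          also have "\<dots> \<le> real (k n) * (\<bar>a n z\<bar> ^ Suc 2 / fact (Suc 2))"
            by (intro mult_left_mono iexp_approx1) simp
          also have "\<dots> \<le> real (k n) * \<bar>a n z\<bar> ^ 3"
            using zero_le_power[of "\<bar>a n z\<bar>" 3] by (intro mult_left_mono) (simp_all add: fact_numeral)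
          also have "\<dots> = (real (k n) * (a n z)\<^sup>2) * \<bar>a n z\<bar>"
          proof -
            have "\<bar>x\<bar> ^ 3 = x\<^sup>2 * \<bar>x\<bar>" for x :: real
              by (cases "0 \<le> x") (simp_all add: power3_eq_cube power2_eq_square)
            then show ?thesis by (simp only: mult.assoc)
          qed
          also have "\<dots> = \<bar>s * (W n z - m n)\<bar>\<^sup>2 * \<bar>a n z\<bar>"
            unfolding ka[OF elim] by (simp add: power_mult_distrib)
          also have "\<dots> = \<bar>s * (W n z - m n)\<bar> ^ 3 * (1 / sqrt (real (k n)))"
            unfolding a_def by (simp add: abs_divide power3_eq_cube power2_eq_square)
          finally show ?case .
        qed
      qed
      from tendsto_add[OF this quad] show ?case by simp
    qed
    have "\<forall>\<^sub>F n in sequentially. \<bar>m n\<bar> < \<theta> + 1"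
      using tendsto_rabs[OF m_lim] \<theta> by (intro order_tendstoD) auto
    then show "\<forall>\<^sub>F n in sequentially. AE z in exp_law. norm (D n z) \<le> s\<^sup>2 / 2 * (B * (z + z\<^sup>2) + (\<theta> + 1))\<^sup>2"
      using W_bound k1
    proof eventually_elim
      fix n assume mb: "\<bar>m n\<bar> < \<theta> + 1" and Wb: "\<forall>z\<ge>0. \<bar>W n z\<bar> \<le> (2 * \<theta> + 26 - 2 * \<rho>) * (z + z\<^sup>2)" and k1: "1 \<le> real (k n)"
      show "AE z in exp_law. norm (D n z) \<le> s\<^sup>2 / 2 * (B * (z + z\<^sup>2) + (\<theta> + 1))\<^sup>2"
        using AE_exp_law_pos
      proof eventually_elim
        fix z :: real assume z: "0 < z"
        \<comment> \<open>For domination the Taylor polynomial stops one order earlier: k times the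
          quadratic remainder no longer contains k.\<close>
        have "norm (D n z) = real (k n) * norm (iexp (a n z) - (\<Sum>j\<le>1. (\<i> * a n z) ^ j / fact j))"
          unfolding D_def by (simp add: norm_mult diff_diff_eq)
        also have "\<dots> \<le> real (k n) * (\<bar>a n z\<bar> ^ Suc 1 / fact (Suc 1))"
          by (intro mult_left_mono iexp_approx1) simp
        also have "\<dots> = (real (k n) * (a n z)\<^sup>2) / 2" by (simp add: numeral_2_eq_2)
        also have "\<dots> = s\<^sup>2 / 2 * (W n z - m n)\<^sup>2" unfolding ka[OF k1] by simp
        also have "\<dots> \<le> s\<^sup>2 / 2 * (B * (z + z\<^sup>2) + (\<theta> + 1))\<^sup>2"
        proof -
          have "\<bar>W n z\<bar> \<le> B * (z + z\<^sup>2)" using Wb z by (simp add: B_def)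
          then have "\<bar>W n z - m n\<bar> \<le> \<bar>B * (z + z\<^sup>2) + (\<theta> + 1)\<bar>" using mb by linarith
          then show ?thesis by (intro mult_left_mono) (simp_all add: abs_le_square_iff)
        qed
        finally show "norm (D n z) \<le> s\<^sup>2 / 2 * (B * (z + z\<^sup>2) + (\<theta> + 1))\<^sup>2" .
      qed
    qed
  qed simp_all
  moreover have "(LINT z|exp_law. complex_of_real (- (s\<^sup>2 * (\<theta> * z - \<theta>)\<^sup>2 / 2))) = complex_of_real (- (s\<^sup>2 * \<theta>\<^sup>2 / 2))"
  proof -
    have "(LINT z|exp_law. - (s\<^sup>2 * (\<theta> * z - \<theta>)\<^sup>2 / 2)) = (LINT z|exp_law. - (s\<^sup>2 * \<theta>\<^sup>2 / 2) * (-2 * z + 1 * z\<^sup>2) + - (s\<^sup>2 * \<theta>\<^sup>2 / 2))"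
      by (intro Bochner_Integration.integral_cong) (simp_all add: power2_eq_square field_simps)
    also have "\<dots> = (LINT z|exp_law. - (s\<^sup>2 * \<theta>\<^sup>2 / 2) * (-2 * z + 1 * z\<^sup>2)) + (LINT z|exp_law. - (s\<^sup>2 * \<theta>\<^sup>2 / 2))"
      by (intro Bochner_Integration.integral_add integrable_mult_right Bochner_Integration.integrable_add) simp_all
    also have "\<dots> = - (s\<^sup>2 * \<theta>\<^sup>2 / 2)"
      unfolding integral_exp_law_quadratic by simp
    finally show ?thesis by (simp only: integral_complex_of_real)
  qed
  ultimately have lim: "(\<lambda>n. LINT z|exp_law. D n z) \<longlonglongrightarrow> of_real (- (s\<^sup>2 * \<theta>\<^sup>2 / 2))" by (simp only:)
  have "\<forall>\<^sub>F n in sequentially. (LINT z|exp_law. D n z) = of_nat (k n) * (psi s n - 1)"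
    using W_integrable
  proof eventually_elim
    case (elim n)
    have i1: "integrable exp_law (\<lambda>z. iexp (a n z))"
      by (rule exp_law.integrable_const_bound[where B = 1]) simp_all
    have ia: "integrable exp_law (a n)"
      unfolding a_def using elim by (intro integrable_divide_zero integrable_mult_right Bochner_Integration.integrable_diff) simp_all
    have "(LINT z|exp_law. a n z) = s * (m n - m n) / sqrt (real (k n))"
      unfolding a_def using elim by (simp add: m_def[symmetric])
    then have a0: "(LINT z|exp_law. complex_of_real (a n z)) = 0" by simp
    have "(LINT z|exp_law. D n z) = of_nat (k n) * (LINT z|exp_law. iexp (a n z) - 1 - \<i> * complex_of_real (a n z))"
      unfolding D_def by (rule integral_mult_right_zero)
    also have "(LINT z|exp_law. iexp (a n z) - 1 - \<i> * complex_of_real (a n z))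
      = (LINT z|exp_law. iexp (a n z)) - 1 - \<i> * (LINT z|exp_law. complex_of_real (a n z))"
      using i1 ia by (simp add: integrable_of_real)
    also have "\<dots> = psi s n - 1" unfolding a0 by (simp add: psi_def a_def)
    finally show ?case .
  qed
  with lim show ?thesis by (rule Lim_transform_eventually)
qed

lemma psi_norm_le: "norm (psi s n) \<le> 1"
proof -
  have "norm (psi s n) \<le> (LINT z|exp_law. norm (iexp (s * (W n z - m n) / sqrt (real (k n)))))"
    unfolding psi_def by (rule integral_norm_bound)
  also have "\<dots> = 1" by simp
  finally show ?thesis .
qed

text \<open>Factoring the mean out of every summand turns the integral into \<open>psi\<close> and a
  phase; the phase combines with the centring and tends to 1.\<close>

lemma conditional_char_lim:
  "(\<lambda>n. iexp (s * - (sqrt (real (k n)) * (\<theta> * mu0 (t n) / T n + b (t n)))) *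
      (LINT z|exp_law. iexp (s * (1 / (T n * sqrt (real (k n)))) * (ln (q (y n + z)) - ln (q (y n))))) ^ (k n - 1))
    \<longlonglongrightarrow> of_real (exp (- (s\<^sup>2 * \<theta>\<^sup>2 / 2)))"
proof -
  \<comment> \<open>The last term reflects that \<open>k - 1\<close> means are added while the
    centring accounts for \<open>k\<close>.\<close>
  define d where "d n = sqrt (real (k n)) * (m n - \<theta> * mu0 (t n) / T n - b (t n)) - m n * (1 / sqrt (real (k n)))" for n
  have "d \<longlonglongrightarrow> 0 - \<theta> * 0"
    unfolding d_def by (intro tendsto_diff tendsto_mult mean_lim m_lim
        tendsto_divide_0[OF tendsto_const] filterlim_at_top_imp_at_infinity sqrt_k)
  then have "(\<lambda>n. iexp (s * d n)) \<longlonglongrightarrow> exp (\<i> * of_real (s * 0))"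
    by (intro tendsto_exp tendsto_mult tendsto_of_real tendsto_const) simp
  then have "(\<lambda>n. iexp (s * d n) * psi s n ^ (k n - 1)) \<longlonglongrightarrow> exp (\<i> * of_real (s * 0)) * of_real (exp (- (s\<^sup>2 * \<theta>\<^sup>2 / 2)))"
    by (intro tendsto_mult power_tendsto_exp[OF k psi_norm_le psi_lim]) simp_all
  then have lim: "(\<lambda>n. iexp (s * d n) * psi s n ^ (k n - 1)) \<longlonglongrightarrow> of_real (exp (- (s\<^sup>2 * \<theta>\<^sup>2 / 2)))"
    by simp
  have "\<forall>\<^sub>F n in sequentially. real (k n) \<ge> 1"
    using k_real by (rule filterlim_at_top[THEN iffD1, rule_format])
  then have "\<forall>\<^sub>F n in sequentially. iexp (s * d n) * psi s n ^ (k n - 1) =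
      iexp (s * - (sqrt (real (k n)) * (\<theta> * mu0 (t n) / T n + b (t n)))) *
      (LINT z|exp_law. iexp (s * (1 / (T n * sqrt (real (k n)))) * (ln (q (y n + z)) - ln (q (y n))))) ^ (k n - 1)"
  proof eventually_elim
    case (elim n)
    let ?r = "sqrt (real (k n))"
    have r: "?r > 0" "?r * ?r = real (k n)" using elim by auto
    have "s * (1 / (T n * ?r)) * (ln (q (y n + z)) - ln (q (y n))) = s * m n / ?r + s * (W n z - m n) / ?r" for z
      by (simp add: W_def add_divide_distrib[symmetric] algebra_simps)
    then have "(LINT z|exp_law. iexp (s * (1 / (T n * ?r)) * (ln (q (y n + z)) - ln (q (y n)))))
        = (LINT z|exp_law. iexp (s * m n / ?r) * iexp (s * (W n z - m n) / ?r))"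
      by (simp only: of_real_add distrib_left exp_add)
    also have "\<dots> = iexp (s * m n / ?r) * psi s n" unfolding psi_def by (rule integral_mult_right_zero)
    finally have e: "(LINT z|exp_law. iexp (s * (1 / (T n * ?r)) * (ln (q (y n + z)) - ln (q (y n))))) = iexp (s * m n / ?r) * psi s n" .
    have "iexp (s * m n / ?r) ^ (k n - 1) = iexp (real (k n - 1) * (s * m n / ?r))"
      by (subst exp_of_nat_mult[symmetric]) (simp add: mult_ac)
    moreover have "s * - (?r * (\<theta> * mu0 (t n) / T n + b (t n))) + real (k n - 1) * (s * m n / ?r) = s * d n"
    proof -
      have "real (k n - 1) = ?r * ?r - 1" using elim r by simp
      then have "real (k n - 1) * (s * m n / ?r) = s * m n * (?r - 1 / ?r)" using r(1) by (simp add: field_simps)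
      then show ?thesis by (simp add: d_def algebra_simps)
    qed
    ultimately show ?case
      unfolding e power_mult_distrib by (metis (no_types, opaque_lifting) distrib_left exp_add mult.assoc of_real_add)
  qed
  with lim show ?thesis by (rule Lim_transform_eventually)
qed

end

section \<open>Integrating out the threshold\<close>

text \<open>Choosing a worst point of each window, whenever a bad one exists, gives an admissible
  sequence; convergence along it excludes bad points eventually. The points \<open>t n\<close> only
  fill in where no bad point exists.\<close>

lemma eventually_uniform_from_sequences:
  fixes \<Phi> :: "nat \<Rightarrow> real \<Rightarrow> 'b::metric_space"
  assumes ne: "\<And>n. t n \<in> A n" and \<epsilon>: "0 < \<epsilon>"
    and seq: "\<And>y. (\<And>n. y n \<in> A n) \<Longrightarrow> (\<lambda>n. \<Phi> n (y n)) \<longlonglongrightarrow> \<phi>"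
  shows "\<forall>\<^sub>F n in sequentially. \<forall>y\<in>A n. dist (\<Phi> n y) \<phi> < \<epsilon>"
proof -
  define y where "y n = (if \<exists>y\<in>A n. \<not> dist (\<Phi> n y) \<phi> < \<epsilon> then SOME y. y \<in> A n \<and> \<not> dist (\<Phi> n y) \<phi> < \<epsilon> else t n)" for n
  have y: "y n \<in> A n \<and> ((\<exists>y\<in>A n. \<not> dist (\<Phi> n y) \<phi> < \<epsilon>) \<longrightarrow> \<not> dist (\<Phi> n (y n)) \<phi> < \<epsilon>)" for n
  proof (cases "\<exists>y\<in>A n. \<not> dist (\<Phi> n y) \<phi> < \<epsilon>")
    case True
    then have "\<exists>y. y \<in> A n \<and> \<not> dist (\<Phi> n y) \<phi> < \<epsilon>" by blast
    from someI_ex[OF this] show ?thesis using True by (simp add: y_def)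
  next
    case False
    then show ?thesis using ne by (simp add: y_def)
  qed
  have "\<forall>\<^sub>F n in sequentially. dist (\<Phi> n (y n)) \<phi> < \<epsilon>"
    using y by (intro tendstoD[OF seq] \<epsilon>) auto
  then show ?thesis by eventually_elim (use y in blast)
qed

text \<open>Inside a window of width proportional to k^(-1/2) the integrand is uniformly close to
  its limit. Outside, boundedness and the second-moment estimate make the contribution
  small.\<close>

lemma os_dens_mixture_lim:
  fixes \<Phi> :: "nat \<Rightarrow> real \<Rightarrow> complex" and k :: "nat \<Rightarrow> nat"
  assumes k: "filterlim k at_top sequentially"
    and kn: "\<forall>\<^sub>F n in sequentially. 1 \<le> k n \<and> k n \<le> n"
    and \<Phi>_meas [measurable]: "\<And>n. \<Phi> n \<in> borel_measurable borel"
    and \<Phi>1: "\<And>n y. norm (\<Phi> n y) \<le> 1" and \<phi>1: "norm \<phi> \<le> 1"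
    and seq: "\<And>C y. (\<And>n. sqrt (real (k n)) * \<bar>y n - ln (real n / real (k n))\<bar> \<le> C) \<Longrightarrow> (\<lambda>n. \<Phi> n (y n)) \<longlonglongrightarrow> \<phi>"
  shows "(\<lambda>n. LINT y|exp_law. of_real (os_dens n (k n) y) * \<Phi> n y) \<longlonglongrightarrow> \<phi>"
proof (rule tendstoI)
  fix e :: real assume e: "0 < e"
  \<comment> \<open>6 / C^2 = e / 4, where 6 is the bound 2 on the distance of the integrands times
    the 3 of the deviation estimate.\<close>
  define C where "C = sqrt (24 / e)"
  have C: "0 < C" "6 / C\<^sup>2 = e / 4" using e by (auto simp: C_def)
  have "filterlim (\<lambda>n. sqrt (real (k n))) at_top sequentially"
    by (rule filterlim_compose[OF sqrt_at_top filterlim_compose[OF filterlim_real_sequentially k]])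
  \<comment> \<open>sqrt k >= 2C confines the relative deviation on the good set to [-1/2, 1/2],
    where the logarithm is controlled linearly.\<close>
  then have big: "\<forall>\<^sub>F n in sequentially. sqrt (real (k n)) \<ge> max 1 (2 * C)"
    by (rule filterlim_at_top[THEN iffD1, rule_format])
  define A where "A n = {y. sqrt (real (k n)) * \<bar>y - ln (real n / real (k n))\<bar> \<le> 2 * C}" for n
  have "\<forall>\<^sub>F n in sequentially. \<forall>y\<in>A n. dist (\<Phi> n y) \<phi> < e / 4"
  proof (rule eventually_uniform_from_sequences)
    show "ln (real n / real (k n)) \<in> A n" for n using C by (simp add: A_def)
    show "(\<lambda>n. \<Phi> n (y n)) \<longlonglongrightarrow> \<phi>" if "\<And>n. y n \<in> A n" for y
      using that by (intro seq[of y "2 * C"]) (simp add: A_def)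
  qed (use e in simp)
  then show "\<forall>\<^sub>F n in sequentially. dist (LINT y|exp_law. of_real (os_dens n (k n) y) * \<Phi> n y) \<phi> < e"
    using big kn
  proof eventually_elim
    case (elim n)
    define K where "K = real (k n)"
    have kn': "1 \<le> k n" "k n \<le> n" using elim by auto
    have K: "K \<ge> 1" "real n \<ge> K" using kn' by (auto simp: K_def)
    have sK: "sqrt K \<ge> 2 * C" "sqrt K \<ge> 1" using elim by (auto simp: K_def)
    define dev where "dev y = real n * exp (- y) / K - 1" for y
    \<comment> \<open>The two cases merge into one pointwise bound. If the deviation is small,
      \<open>y\<close> lies in the window; if not, the squared deviation term alone exceeds
      2.\<close>
    have pt: "norm (\<Phi> n y - \<phi>) \<le> e / 4 + 2 * (K / C\<^sup>2) * (dev y)\<^sup>2" for y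
    proof (cases "sqrt K * \<bar>dev y\<bar> \<le> C")
      case True
      then have "\<bar>dev y\<bar> \<le> C / sqrt K" using sK by (simp add: field_simps)
      also have "\<dots> \<le> 1/2" using sK by (simp add: field_simps)
      finally have d: "\<bar>dev y\<bar> \<le> 1/2" .
      have "\<bar>ln (1 + dev y)\<bar> \<le> 2 * \<bar>dev y\<bar>"
      proof -
        have "\<bar>ln (1 + dev y) - dev y\<bar> \<le> 2 * (dev y)\<^sup>2" using d by (rule abs_ln_one_plus_x_minus_x_bound)
        also have "\<dots> = 2 * \<bar>dev y\<bar> * \<bar>dev y\<bar>" by (simp add: power2_eq_square)
        also have "\<dots> \<le> 1 * \<bar>dev y\<bar>" using d by (intro mult_right_mono) auto
        finally show ?thesis by linarith
      qed
      moreover have "ln (1 + dev y) = ln (real n / K) - y"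
      proof -
        have "1 + dev y = real n / K * exp (- y)" by (simp add: dev_def)
        moreover have "0 < real n / K" using K by simp
        then have "ln (real n / K * exp (- y)) = ln (real n / K) + ln (exp (- y))"
          by (rule ln_mult_pos) simp
        ultimately show ?thesis by simp
      qed
      ultimately have "sqrt K * \<bar>y - ln (real n / K)\<bar> \<le> sqrt K * (2 * \<bar>dev y\<bar>)"
        using sK by (intro mult_left_mono) (auto simp: abs_minus_commute)
      also have "\<dots> \<le> 2 * C" using True by simp
      finally have "y \<in> A n" by (simp add: A_def K_def)
      then have "norm (\<Phi> n y - \<phi>) \<le> e / 4" using elim(1) by (auto simp: dist_norm intro: less_imp_le)
      moreover have "0 \<le> 2 * (K / C\<^sup>2) * (dev y)\<^sup>2" using K by simp
      ultimately show ?thesis by linarith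
    next
      case False
      then have "C\<^sup>2 \<le> (sqrt K * \<bar>dev y\<bar>)\<^sup>2" using C by (intro power_mono) auto
      then have "1 \<le> (K / C\<^sup>2) * (dev y)\<^sup>2" using C K by (simp add: power_mult_distrib field_simps)
      moreover have "norm (\<Phi> n y - \<phi>) \<le> 2"
        using norm_triangle_ineq4[of "\<Phi> n y" \<phi>] \<Phi>1[of n y] \<phi>1 by linarith
      ultimately show ?thesis using e by linarith
    qed
    have os_int: "integrable exp_law (\<lambda>y. os_dens n (k n) y)"
      using integrable_os_dens[of "\<lambda>_. 1" 1 n "k n"] by simp
    have dev_int: "integrable exp_law (\<lambda>y. os_dens n (k n) y * (dev y)\<^sup>2)"
    proof (rule integrable_os_dens)
      show "(\<lambda>y. (dev y)\<^sup>2) \<in> borel_measurable borel" unfolding dev_def by measurable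
      show "\<bar>(dev y)\<^sup>2\<bar> \<le> (real n / K + 1)\<^sup>2" if "0 < y" for y
      proof -
        have "real n * exp (- y) / K \<le> real n / K" using that K by (intro divide_right_mono) (auto simp: mult_le_cancel_left1)
        moreover have "0 \<le> real n * exp (- y) / K" using K by simp
        ultimately have "\<bar>dev y\<bar> \<le> \<bar>real n / K + 1\<bar>" unfolding dev_def by linarith
        then show ?thesis by (simp add: abs_le_square_iff)
      qed
    qed
    have bd: "AE y in exp_law. norm (of_real (os_dens n (k n) y) * \<Phi> n y) \<le> os_dens n (k n) y"
      using AE_exp_law_pos
    proof eventually_elim
      case (elim y)
      have "norm (of_real (os_dens n (k n) y) * \<Phi> n y) = os_dens n (k n) y * norm (\<Phi> n y)"
        using os_dens_nonneg[of y n "k n"] elim by (simp add: norm_mult)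
      also have "\<dots> \<le> os_dens n (k n) y * 1"
        using os_dens_nonneg[of y n "k n"] elim \<Phi>1 by (intro mult_left_mono) auto
      finally show ?case by simp
    qed
    have int1: "integrable exp_law (\<lambda>y. of_real (os_dens n (k n) y) * \<Phi> n y)"
      by (rule Bochner_Integration.integrable_bound[OF os_int])
        (measurable, use bd in eventually_elim, auto intro: order_trans[OF _ abs_ge_self])
    have int2: "integrable exp_law (\<lambda>y. of_real (os_dens n (k n) y) * \<phi>)"
      using os_int by (intro integrable_mult_left integrable_of_real)
    have "(LINT y|exp_law. of_real (os_dens n (k n) y) * \<phi>) = \<phi>"
      by (simp add: integral_os_dens[OF kn'])
    then have "(LINT y|exp_law. of_real (os_dens n (k n) y) * \<Phi> n y) - \<phi>
      = (LINT y|exp_law. of_real (os_dens n (k n) y) * \<Phi> n y - of_real (os_dens n (k n) y) * \<phi>)"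
      using Bochner_Integration.integral_diff[OF int1 int2] by simp
    then have "dist (LINT y|exp_law. of_real (os_dens n (k n) y) * \<Phi> n y) \<phi>
      \<le> (LINT y|exp_law. norm (of_real (os_dens n (k n) y) * \<Phi> n y - of_real (os_dens n (k n) y) * \<phi>))"
      unfolding dist_norm by (simp only: integral_norm_bound)
    also have "\<dots> \<le> (LINT y|exp_law. e / 4 * os_dens n (k n) y + 2 * (K / C\<^sup>2) * (os_dens n (k n) y * (dev y)\<^sup>2))"
    proof (rule integral_mono_AE)
      show "integrable exp_law (\<lambda>y. norm (of_real (os_dens n (k n) y) * \<Phi> n y - of_real (os_dens n (k n) y) * \<phi>))"
        using int1 int2 by (intro integrable_norm Bochner_Integration.integrable_diff)
      show "integrable exp_law (\<lambda>y. e / 4 * os_dens n (k n) y + 2 * (K / C\<^sup>2) * (os_dens n (k n) y * (dev y)\<^sup>2))"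
        using os_int dev_int by (intro Bochner_Integration.integrable_add integrable_mult_right)
      show "AE y in exp_law. norm (of_real (os_dens n (k n) y) * \<Phi> n y - of_real (os_dens n (k n) y) * \<phi>)
        \<le> e / 4 * os_dens n (k n) y + 2 * (K / C\<^sup>2) * (os_dens n (k n) y * (dev y)\<^sup>2)"
        using AE_exp_law_pos
      proof eventually_elim
        case (elim y)
        have "norm (of_real (os_dens n (k n) y) * \<Phi> n y - of_real (os_dens n (k n) y) * \<phi>) = os_dens n (k n) y * norm (\<Phi> n y - \<phi>)"
          using os_dens_nonneg[of y n "k n"] elim by (simp add: right_diff_distrib[symmetric] norm_mult)
        also have "\<dots> \<le> os_dens n (k n) y * (e / 4 + 2 * (K / C\<^sup>2) * (dev y)\<^sup>2)"
          using os_dens_nonneg[of y n "k n"] elim pt by (intro mult_left_mono) auto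
        finally show ?case by (simp only: distrib_left mult_ac)
      qed
    qed
    also have "\<dots> = e / 4 + 2 * (K / C\<^sup>2) * (LINT y|exp_law. os_dens n (k n) y * (dev y)\<^sup>2)"
      using os_int dev_int by (subst Bochner_Integration.integral_add) (simp_all add: integral_os_dens[OF kn'])
    also have "\<dots> \<le> e / 4 + 2 * (K / C\<^sup>2) * (3 / K)"
      using integral_os_dens_deviation[OF kn'] K
      by (intro add_left_mono mult_left_mono) (simp_all add: dev_def K_def)
    also have "\<dots> = e / 4 + 6 / C\<^sup>2" using K by simp
    also have "\<dots> < e" using C e by simp
    finally show ?case .
  qed
qed

section \<open>The normal limit and the upper quantile of F\<close>

lemma char_normal_0:
  assumes "0 < \<theta>"
  shows "real_distribution (density lborel (normal_density 0 \<theta>))"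
    and "char (density lborel (normal_density 0 \<theta>)) s = of_real (exp (- (s\<^sup>2 * \<theta>\<^sup>2 / 2)))"
proof -
  interpret prob_space std_normal_distribution by (rule prob_space_normal_density) simp
  have "distributed std_normal_distribution lborel (\<lambda>x. x) (normal_density 0 1)"
    by (auto simp: distributed_def distr_id2)
  from normal_density_affine[OF this, of \<theta> 0] assms
  have "distributed std_normal_distribution lborel (\<lambda>x. \<theta> * x) (normal_density 0 \<theta>)" by simp
  then have "distr std_normal_distribution lborel (\<lambda>x. \<theta> * x) = density lborel (normal_density 0 \<theta>)"
    by (rule distributed_distr_eq_density)
  moreover have "distr std_normal_distribution lborel (\<lambda>x. \<theta> * x) = distr std_normal_distribution borel (\<lambda>x. \<theta> * x)"
    by (intro distr_cong) auto
  ultimately have eq: "density lborel (normal_density 0 \<theta>) = distr std_normal_distribution borel (\<lambda>x. \<theta> * x)" by simp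
  show "real_distribution (density lborel (normal_density 0 \<theta>))"
    unfolding eq by (rule real_distribution_distr) simp
  have "char (density lborel (normal_density 0 \<theta>)) s = char std_normal_distribution (s * \<theta>)"
    unfolding eq char_def by (subst integral_distr) (simp_all add: mult_ac)
  then show "char (density lborel (normal_density 0 \<theta>)) s = of_real (exp (- (s\<^sup>2 * \<theta>\<^sup>2 / 2)))"
    by (simp add: char_std_normal_distribution power_mult_distrib)
qed

text \<open>Above the level \<open>H x0\<close> no point left of \<open>x0\<close> can reach 1 -
  exp(-y), so both infima run over the same set.\<close>

lemma quantile_exp_eq_gen_inv:
  fixes F H :: "real \<Rightarrow> real"
  assumes F: "mono F" and A1: "\<And>x. x \<ge> x0 \<Longrightarrow> 1 - F x = exp (- H x)" and y: "0 < y" "H x0 < y"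
  shows "quantile_exp F y = gen_inv H x0 y"
proof -
  have "1 - exp (- y) \<le> F x \<longleftrightarrow> x0 \<le> x \<and> y \<le> H x" for x
  proof (cases "x0 \<le> x")
    case True
    then have "F x = 1 - exp (- H x)" using A1[of x] by simp
    then show ?thesis using True by simp
  next
    case False
    then have "F x \<le> F x0" by (intro monoD[OF F]) simp
    also have "F x0 = 1 - exp (- H x0)" using A1[of x0] by simp
    also have "\<dots> < 1 - exp (- y)" using y by simp
    finally show ?thesis using False by simp
  qed
  then show ?thesis using y by (simp add: quantile_exp_def gen_inv_def)
qed

theorem theorem1:
  fixes M :: "'a measure" and X :: "nat \<Rightarrow> 'a \<Rightarrow> real"
    and \<theta> x0 \<rho> lam :: real and H L b :: "real \<Rightarrow> real" and T :: "nat \<Rightarrow> real" and k :: "nat \<Rightarrow> nat"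
  defines "F \<equiv> cdf (distr M borel (X 1))"
  assumes "prob_space M"
    and rv: "\<And>i. X i \<in> borel_measurable M"
    and indep: "prob_space.indep_vars M (\<lambda>_. borel) X UNIV"
    and ident: "\<And>i. distr M borel (X i) = distr M borel (X 1)"
    \<comment> \<open>(A.1)\<close>
    and "\<theta> > 0" and "x0 \<ge> 0"
    and A1: "\<And>x. x \<ge> x0 \<Longrightarrow> 1 - F x = exp (- H x)"
    and sv: "slowly_varying L"
    and Hinv: "\<forall>\<^sub>F t in at_top. gen_inv H x0 t = t powr \<theta> * L t"
    \<comment> \<open>(A.2)\<close>
    and "\<rho> \<le> 0" and b0: "(b \<longlongrightarrow> 0) at_top"
    and A2: "\<And>\<Lambda> \<epsilon>. \<Lambda> \<ge> 1 \<Longrightarrow> \<epsilon> > 0 \<Longrightarrow>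
       \<forall>\<^sub>F x in at_top. \<forall>u\<in>{1..\<Lambda>}.
          \<bar>ln (L (u * x) / L x) - b x * K_rho \<rho> u\<bar> \<le> \<epsilon> * \<bar>b x * K_rho \<rho> u\<bar>"
    \<comment> \<open>sequences\<close>
    and kn: "\<And>n. n \<ge> 2 \<Longrightarrow> 1 \<le> k n \<and> k n < n"
    and Tpos: "\<And>n. T n > 0"
    and k_inf: "filterlim k at_top sequentially"
    and k_o: "(\<lambda>n. real (k n) / real n) \<longlonglongrightarrow> 0"
    and T_lim: "(\<lambda>n. T n * ln (real n / real (k n))) \<longlonglongrightarrow> 1"
    and lam_lim: "(\<lambda>n. sqrt (real (k n)) * b (ln (real n / real (k n)))) \<longlonglongrightarrow> lam"
  shows "weak_conv_m
           (\<lambda>n. distr M borel (\<lambda>\<omega>. sqrt (real (k n)) *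
              (theta_hat X k T n \<omega> - \<theta> - b (ln (real n / real (k n)))
               - \<theta> * (mu0 (ln (real n / real (k n))) / T n - 1))))
           (density lborel (normal_density 0 \<theta>))"
proof -
  interpret prob_space M by fact
  note [measurable] = rv
  interpret D: real_distribution "distr M borel (X 1)" by (rule real_distribution_distr) simp
  define q where "q = quantile_exp F"
  define t where "t n = ln (real n / real (k n))" for n
  have q_meas [measurable]: "q \<in> borel_measurable borel" unfolding q_def F_def by (rule D.quantile_exp_measurable)
  have L_pos: "\<forall>\<^sub>F x in at_top. L x > 0" using sv by (simp add: slowly_varying_def)
  have qL: "\<forall>\<^sub>F x in at_top. q x = x powr \<theta> * L x"
    using Hinv eventually_gt_at_top[of 0] eventually_gt_at_top[of "H x0"]
  proof eventually_elim
    case (elim y)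
    have "mono F" unfolding F_def by (rule monoI) (rule D.cdf_nondecreasing)
    then show ?case using quantile_exp_eq_gen_inv[of F x0 H y] A1 elim by (simp add: q_def)
  qed
  have ev2: "\<forall>\<^sub>F n in sequentially. n \<ge> (2::nat)" by (rule eventually_ge_at_top)
  have t: "filterlim t at_top sequentially"
  proof -
    have "\<forall>\<^sub>F n in sequentially. 0 < real (k n) / real n"
      using ev2 by eventually_elim (use kn in \<open>force intro!: divide_pos_pos\<close>)
    with k_o have "filterlim (\<lambda>n. inverse (real (k n) / real n)) at_top sequentially"
      by (rule filterlim_inverse_at_top)
    then have "filterlim (\<lambda>n. real n / real (k n)) at_top sequentially" by simp
    then show ?thesis unfolding t_def by (rule filterlim_compose[OF ln_at_top])
  qed
  define S where "S n \<omega> = sqrt (real (k n)) * (theta_hat X k T n \<omega> - \<theta> - b (t n) - \<theta> * (mu0 (t n) / T n - 1))" for n \<omega>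
  have S_meas [measurable]: "S n \<in> borel_measurable M" for n
    unfolding S_def theta_hat_def by measurable
  \<comment> \<open>The characteristic function of the normalised statistic given that the k-th
    largest exponential equals \<open>y\<close>.\<close>
  define \<Phi> where "\<Phi> s n y = iexp (s * - (sqrt (real (k n)) * (\<theta> * mu0 (t n) / T n + b (t n)))) *
      (LINT z|exp_law. iexp (s * (1 / (T n * sqrt (real (k n)))) * (ln (q (y + z)) - ln (q y)))) ^ (k n - 1)" for s n y
  have \<Phi>_meas: "\<Phi> s n \<in> borel_measurable borel" for s n
    unfolding \<Phi>_def by measurable
  have \<Phi>1: "norm (\<Phi> s n y) \<le> 1" for s n y
  proof -
    have "norm (LINT z|exp_law. iexp (s * (1 / (T n * sqrt (real (k n)))) * (ln (q (y + z)) - ln (q y)))) \<le> 1"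
      by (rule order_trans[OF integral_norm_bound]) simp
    then show ?thesis unfolding \<Phi>_def by (simp add: norm_mult norm_power power_le_one)
  qed
  have char_S: "char (distr M borel (S n)) s = (LINT y|exp_law. of_real (os_dens n (k n) y) * \<Phi> s n y)"
    if n: "n \<ge> 2" for n s
  proof -
    have r: "sqrt (real (k n)) > 0" "real (k n) = sqrt (real (k n)) * sqrt (real (k n))" using kn[OF n] by auto
    \<comment> \<open>theta and theta a_n merge into theta * \<open>mu0 (t n)\<close> / T_n, so the
      statistic is an affine function of the log-spacing sum.\<close>
    have S_eq: "S n = (\<lambda>\<omega>. 1 / (T n * sqrt (real (k n))) *
       (\<Sum>i=1..k n. ln (order_stat X n (n - i + 1) \<omega>) - ln (order_stat X n (n - k n + 1) \<omega>))
       + - (sqrt (real (k n)) * (\<theta> * mu0 (t n) / T n + b (t n))))"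
    proof
      fix \<omega>
      define \<Sigma> where "\<Sigma> = (\<Sum>i=1..k n. ln (order_stat X n (n - i + 1) \<omega>) - ln (order_stat X n (n - k n + 1) \<omega>))"
      have "sqrt (real (k n)) * (1 / T n * (1 / real (k n)) * \<Sigma>) = 1 / (T n * sqrt (real (k n))) * \<Sigma>"
      proof -
        have "r * (1 / T n * (1 / (r * r)) * \<Sigma>) = 1 / (T n * r) * \<Sigma>" if "r > 0" for r
          using that by simp
        from this[OF r(1)] show ?thesis unfolding r(2)[symmetric] .
      qed
      then show "S n \<omega> = 1 / (T n * sqrt (real (k n))) * \<Sigma> + - (sqrt (real (k n)) * (\<theta> * mu0 (t n) / T n + b (t n)))"
        unfolding S_def theta_hat_def \<Sigma>_def[symmetric] by (simp add: algebra_simps)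
    qed
    show ?thesis
      unfolding S_eq \<Phi>_def q_def F_def
      by (intro char_hill_statistic[OF \<open>prob_space M\<close> rv indep ident]) (use kn[OF n] in simp_all)
  qed
  have "weak_conv_m (\<lambda>n. distr M borel (S n)) (density lborel (normal_density 0 \<theta>))"
  proof (rule levy_continuity)
    show "real_distribution (distr M borel (S n))" for n by (rule real_distribution_distr) simp
    show "real_distribution (density lborel (normal_density 0 \<theta>))" by (rule char_normal_0) fact
    fix s
    have "(\<lambda>n. LINT y|exp_law. of_real (os_dens n (k n) y) * \<Phi> s n y) \<longlonglongrightarrow> of_real (exp (- (s\<^sup>2 * \<theta>\<^sup>2 / 2)))"
    proof (rule os_dens_mixture_lim[OF k_inf])
      show "\<forall>\<^sub>F n in sequentially. 1 \<le> k n \<and> k n \<le> n"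
        using ev2 by eventually_elim (use kn in force)
      show "norm (of_real (exp (- (s\<^sup>2 * \<theta>\<^sup>2 / 2))) :: complex) \<le> 1" by (simp add: norm_of_real)
      fix C y
      assume "\<And>n. sqrt (real (k n)) * \<bar>y n - ln (real n / real (k n))\<bar> \<le> C"
      then have yC: "\<forall>\<^sub>F n in sequentially. sqrt (real (k n)) * \<bar>y n - t n\<bar> \<le> C" by (simp add: t_def)
      \<comment> \<open>The interpretation is made anew for each admissible sequence, since
        \<open>C\<close> and \<open>y\<close> vary with it.\<close>
      interpret hill_sequence q L b \<theta> \<rho> lam C k T t y
        by unfold_locales
          (fact \<open>\<rho> \<le> 0\<close> \<open>\<theta> > 0\<close> q_meas L_pos qL b0 A2 k_inf t Tpos T_lim[folded t_def] lam_lim[folded t_def] yC)+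
      show "(\<lambda>n. \<Phi> s n (y n)) \<longlonglongrightarrow> of_real (exp (- (s\<^sup>2 * \<theta>\<^sup>2 / 2)))"
        unfolding \<Phi>_def by (rule conditional_char_lim)
    qed (rule \<Phi>_meas \<Phi>1)+
    \<comment> \<open>The mixture formula needs \<open>1 \<le> k n \<le> n\<close>, which is
      available from \<open>n = 2\<close> on; the limit is unaffected.\<close>
    moreover have "\<forall>\<^sub>F n in sequentially. (LINT y|exp_law. of_real (os_dens n (k n) y) * \<Phi> s n y) = char (distr M borel (S n)) s"
      using ev2 by eventually_elim (simp add: char_S)
    ultimately show "(\<lambda>n. char (distr M borel (S n)) s) \<longlonglongrightarrow> char (density lborel (normal_density 0 \<theta>)) s"
      unfolding char_normal_0(2)[OF \<open>\<theta> > 0\<close>] by (rule Lim_transform_eventually)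
  qed
  then show ?thesis unfolding S_def t_def .
qed

end
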